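(* Let $G=SP(w;\ell_1,\dots,\ell_k)$ be a spider with $k\ge 3$ legs, with $1\le \ell_1\le\ell_2\le\dots\le\ell_k$. Let (E) denote the condition that one of the following holds: - $k=4$ and either $\ell_2\le 2$ or ($\ell_2=3$ and $\ell_4\le 4$); - $k=5$ and either $\ell_3=1$ or $\ell_5=2$; - $k\ge 6$, $\ell_2=1$ and $\ell_k=2$. Then $$\operatorname{ldc}(G)=\begin{cases}3,&\text{if }\ell_k=1,\\ \ell_3+2,&\text{if }k=3\text{ and }\ell_1=1,\\ \lfloor \ell_3/2\rfloor+2,&\text{if }k=3\text{ and }\ell_1\ge 2,\\ \lceil \ell_k/2\rceil+2,&\text{if }k\ge4,\ \ell_1=1\text{ and (E) holds},\\ \lceil \ell_k/2\rceil+1,&\text{otherwise.}\end{cases}$$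
   Context: All graphs are finite, simple and connected; $d(u,v)$ denotes graph distance. For a graph $G$ on $n$ vertices, a labeling is a bijection $c:V(G)\to\{1,\dots,n\}$; write $c(u,v)=|c(u)-c(v)|$. A vertex $u$ is (list-distance) consistent under $c$ if for all $v,w\in V(G)$, $d(u,v)<d(u,w)$ implies $c(u,v)\le c(u,w)$. $S_c(G)$ denotes the set of consistent vertices under $c$, and $\operatorname{ldc}(G)=\max_c|S_c(G)|$ over all labelings $c$ of $G$. A spider is a tree with exactly one vertex $w$ of degree greater than $2$ (the body); the components of $G-w$, each of which is a path, are its legs. $SP(w;\ell_1,\dots,\ell_k)$ denotes the spider with body $w$ and $k\ge3$ legs having $\ell_1\le\ell_2\le\dots\le\ell_k$ vertices (all $\ell_i\ge1$). *)

theory Defs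
  imports "Graph_Theory.Graph_Theory"
begin

text \<open>
  A finite simple graph is a \<open>pair_graph\<close>: a finite vertex set with a symmetric,
  irreflexive set of arcs, each undirected edge being present as two opposite arcs.
  Consequently the degree of a vertex is its \<open>out_degree\<close>, and the connected
  components of a graph are its strongly connected components.
\<close>

definition graph_dist :: "'a pair_pre_digraph \<Rightarrow> 'a \<Rightarrow> 'a \<Rightarrow> ereal" where
  "graph_dist G u v = wf_digraph.\<mu> (with_proj G) (\<lambda>_. 1) u v"

definition labeling :: "'a pair_pre_digraph \<Rightarrow> ('a \<Rightarrow> nat) \<Rightarrow> bool" where
  "labeling G c \<longleftrightarrow> bij_betw c (pverts G) {1..card (pverts G)}"

definition label_dist :: "('a \<Rightarrow> nat) \<Rightarrow> 'a \<Rightarrow> 'a \<Rightarrow> int" where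
  "label_dist c u v = \<bar>int (c u) - int (c v)\<bar>"

definition consistent :: "'a pair_pre_digraph \<Rightarrow> ('a \<Rightarrow> nat) \<Rightarrow> 'a \<Rightarrow> bool" where
  "consistent G c u \<longleftrightarrow>
     (\<forall>v\<in>pverts G. \<forall>w\<in>pverts G.
        graph_dist G u v < graph_dist G u w \<longrightarrow> label_dist c u v \<le> label_dist c u w)"

definition consistent_verts :: "'a pair_pre_digraph \<Rightarrow> ('a \<Rightarrow> nat) \<Rightarrow> 'a set" where
  "consistent_verts G c = {u \<in> pverts G. consistent G c u}"

definition ldc :: "'a pair_pre_digraph \<Rightarrow> nat" where
  "ldc G = Max {card (consistent_verts G c) | c. labeling G c}"

text \<open>
  The library predicate \<open>tree\<close> is unsuitable here: it counts the closed walk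
  \<open>a, b, a\<close> along a single undirected edge as a cycle. The cycles of an undirected
  simple graph are the directed ones of length at least 3.
\<close>

definition undirected_tree :: "'a pair_pre_digraph \<Rightarrow> bool" where
  "undirected_tree G \<longleftrightarrow>
     Digraph_Component.connected (with_proj G) \<and>
     \<not> (\<exists>p. pre_digraph.cycle (with_proj G) p \<and> length p \<ge> 3)"

definition spider :: "'a pair_pre_digraph \<Rightarrow> 'a \<Rightarrow> bool" where
  "spider G w \<longleftrightarrow> pair_graph G \<and> undirected_tree G \<and> w \<in> pverts G \<and>
     (\<forall>v\<in>pverts G. out_degree (with_proj G) v > 2 \<longleftrightarrow> v = w)"

definition legs :: "'a pair_pre_digraph \<Rightarrow> 'a \<Rightarrow> 'a set set" where
  "legs G w = pre_digraph.sccs_verts (pre_digraph.del_vert (with_proj G) w)"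

text \<open>
  \<open>is_SP G w k l\<close> says that \<open>G\<close> is \<open>SP(w; l 1, \<dots>, l k)\<close>; the function \<open>l\<close> is only
  relevant on \<open>{1..k}\<close>.
\<close>

definition is_SP :: "'a pair_pre_digraph \<Rightarrow> 'a \<Rightarrow> nat \<Rightarrow> (nat \<Rightarrow> nat) \<Rightarrow> bool" where
  "is_SP G w k l \<longleftrightarrow> spider G w \<and> k \<ge> 3 \<and>
     (\<forall>i\<in>{1..k}. 1 \<le> l i) \<and> (\<forall>i\<in>{1..k}. \<forall>j\<in>{1..k}. i \<le> j \<longrightarrow> l i \<le> l j) \<and>
     (\<exists>L. bij_betw L {1..k} (legs G w) \<and> (\<forall>i\<in>{1..k}. card (L i) = l i))"

definition condition_E :: "nat \<Rightarrow> (nat \<Rightarrow> nat) \<Rightarrow> bool" where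
  "condition_E k l \<longleftrightarrow>
     (k = 4 \<and> (l 2 \<le> 2 \<or> (l 2 = 3 \<and> l 4 \<le> 4))) \<or>
     (k = 5 \<and> (l 3 = 1 \<or> l 5 = 2)) \<or>
     (k \<ge> 6 \<and> l 2 = 1 \<and> l k = 2)"

end

theory Submission
  imports Defs
begin

text \<open>
  If \<open>u\<close> and \<open>v\<close> are consistent, then the labels of the geodesic from \<open>u\<close> to \<open>v\<close> are consecutive integers
  in monotone order: \<open>u\<close> forces the distances from it to increase along the labels between them, \<open>v\<close>
  forces the distances to it to decrease, and a vertex \<open>z\<close> squeezed between two neighbours of the
  geodesic would satisfy \<open>d u z + d v z \<le> d u v + 1\<close>, which in a tree puts \<open>z\<close> on the geodesic. Hence no
  three consistent vertices lie on three different legs.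

  On a single leg, let the consistent vertex at distance \<open>p\<close> from the body be closer to the body than
  another consistent vertex. Counting the labels of balls around these two vertices shows that \<open>p\<close> is at
  least about half the length of the leg. If consistent vertices lie on two legs, one of these legs
  contributes only its vertex next to the body, and a consistent vertex of the other leg at distance at
  least 2 from the body makes that vertex a leaf whose balls restrict the remaining legs; condition (E)
  is this restriction.

  For the converse, label one leg from its end towards the body, and then everything else by distance
  from the body.
\<close>

text \<open>The number of legs enters through one count. Let \<open>p < q\<close> be consistent
  depths on leg \<open>b\<close>. The first vertex beyond \<open>p\<close> that is farther from
  \<open>f b p\<close> than the body's neighbours on the other legs is
  \<open>f b (2 * p + 2)\<close>. Its label differs from that of \<open>f b p\<close> by some
  \<open>m <= p + 2\<close>, because the relevant ball around \<open>f b q\<close> stays inside the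
  leg. Yet \<open>2 * p + 1 + k\<close> vertices are nearer to \<open>f b p\<close> and must share
  \<open>2 * m\<close> labels. This excludes \<open>k >= 4\<close>, while \<open>k = 3\<close> fits
  exactly. That exact fit is the obstacle for three legs: the count has to be repeated at depth
  \<open>2 * p + 3\<close>, and for \<open>q = p + 1\<close> the ball around \<open>f b q\<close>
  then spills over the body. Condition (E) has a similar origin. If \<open>f a 1\<close> is a
  consistent leaf opposite to a consistent \<open>f b q\<close>, then for each \<open>h < q\<close>
  the vertices of the remaining legs at depth at most \<open>h\<close> share \<open>h + 2\<close>
  free labels. Only \<open>(l b + 1) div 2 = (l k + 1) div 2\<close> matters for the optimum, so leg
  \<open>b\<close> need not be a longest one; this explains the isolated cases with lengths 3, 4 and
  1, 2 in (E).\<close>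

lemma rank_labeling:
  fixes key :: "'b \<Rightarrow> nat"
  assumes fin: "finite A" and inj: "inj_on key A"
  defines "c \<equiv> \<lambda>v. card {x \<in> A. key x \<le> key v}"
  shows "bij_betw c A {1..card A}"
    and "u \<in> A \<Longrightarrow> v \<in> A \<Longrightarrow> key u < key v \<Longrightarrow> c u < c v"
proof -
  show mono: "c u < c v" if "u \<in> A" "v \<in> A" "key u < key v" for u v
  proof -
    have "v \<in> {x \<in> A. key x \<le> key v}" "v \<notin> {x \<in> A. key x \<le> key u}" using that by auto
    moreover have "{x \<in> A. key x \<le> key u} \<subseteq> {x \<in> A. key x \<le> key v}" using that by auto
    ultimately have "{x \<in> A. key x \<le> key u} \<subset> {x \<in> A. key x \<le> key v}" by blast
    then show ?thesis unfolding c_def using fin by (intro psubset_card_mono) auto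
  qed
  have inj_c: "inj_on c A"
  proof (rule inj_onI)
    fix u v assume uv: "u \<in> A" "v \<in> A" "c u = c v"
    then have "key u = key v" using mono[of u v] mono[of v u] by (cases "key u" "key v" rule: linorder_cases) auto
    then show "u = v" using inj uv unfolding inj_on_def by blast
  qed
  have "c ` A \<subseteq> {1..card A}"
  proof
    fix y assume "y \<in> c ` A"
    then obtain v where v: "v \<in> A" "y = c v" by blast
    have "card {v} \<le> c v" unfolding c_def using fin v by (intro card_mono) auto
    then have "1 \<le> c v" by simp
    moreover have "c v \<le> card A" unfolding c_def using fin by (intro card_mono) auto
    ultimately show "y \<in> {1..card A}" using v by simp
  qed
  then have "c ` A = {1..card A}" using inj_c by (intro card_subset_eq) (simp_all add: card_image)
  then show "bij_betw c A {1..card A}" using inj_c unfolding bij_betw_def by blast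
qed

subsection \<open>Labelings of a spider in coordinates\<close>

text \<open>\<open>f i j\<close> is the vertex of the \<open>i\<close>-th leg at distance \<open>j\<close> from the body; \<open>f i 0\<close> is the body for
  every \<open>i\<close>.\<close>

locale spider_metric =
  fixes k :: nat and l :: "nat \<Rightarrow> nat" and f :: "nat \<Rightarrow> nat \<Rightarrow> 'a" and d :: "'a \<Rightarrow> 'a \<Rightarrow> nat"
  assumes k_ge: "3 \<le> k"
    and l_pos: "i \<in> {1..k} \<Longrightarrow> 1 \<le> l i"
    and l_mono: "i \<in> {1..k} \<Longrightarrow> j \<in> {1..k} \<Longrightarrow> i \<le> j \<Longrightarrow> l i \<le> l j"
    and d_f: "i \<in> {1..k} \<Longrightarrow> i' \<in> {1..k} \<Longrightarrow> j \<le> l i \<Longrightarrow> j' \<le> l i' \<Longrightarrow>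
      d (f i j) (f i' j') = (if i = i' then (j - j') + (j' - j) else j + j')"
    and d_zero: "i \<in> {1..k} \<Longrightarrow> i' \<in> {1..k} \<Longrightarrow> j \<le> l i \<Longrightarrow> j' \<le> l i' \<Longrightarrow>
      d (f i j) (f i' j') = 0 \<Longrightarrow> f i j = f i' j'"
begin

definition V :: "'a set" where
  "V = {f i j | i j. i \<in> {1..k} \<and> j \<le> l i}"

definition consistent_at :: "('a \<Rightarrow> int) \<Rightarrow> 'a \<Rightarrow> bool" where
  "consistent_at c u \<longleftrightarrow> (\<forall>v\<in>V. \<forall>v'\<in>V. d u v < d u v' \<longrightarrow> \<bar>c u - c v\<bar> \<le> \<bar>c u - c v'\<bar>)"

text \<open>Integer labels from an arbitrary interval can be negated, which reverses the orientation.\<close>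

definition interval_labeling :: "('a \<Rightarrow> int) \<Rightarrow> bool" where
  "interval_labeling c \<longleftrightarrow> inj_on c V \<and> (\<exists>A B. c ` V = {A..B})"

lemma f_in_V [simp, intro]: "i \<in> {1..k} \<Longrightarrow> j \<le> l i \<Longrightarrow> f i j \<in> V"
  unfolding V_def by blast

lemma V_cases:
  assumes "v \<in> V" obtains i j where "i \<in> {1..k}" "j \<le> l i" "v = f i j"
  using assms unfolding V_def by blast

lemma d_same:
  "i \<in> {1..k} \<Longrightarrow> j \<le> l i \<Longrightarrow> j' \<le> l i \<Longrightarrow> d (f i j) (f i j') = (j - j') + (j' - j)"
  by (simp add: d_f)

lemma d_diff:
  "i \<in> {1..k} \<Longrightarrow> i' \<in> {1..k} \<Longrightarrow> i \<noteq> i' \<Longrightarrow> j \<le> l i \<Longrightarrow> j' \<le> l i' \<Longrightarrow> d (f i j) (f i' j') = j + j'"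
  by (simp add: d_f)

lemma f_eq:
  assumes "i \<in> {1..k}" "i' \<in> {1..k}" "j \<le> l i" "j' \<le> l i'"
  shows "f i j = f i' j' \<longleftrightarrow> j = j' \<and> (i = i' \<or> j = 0)"
proof
  assume e: "f i j = f i' j'"
  have "d (f i j) (f i' j') = 0"
    unfolding e using assms by (simp add: d_f)
  then show "j = j' \<and> (i = i' \<or> j = 0)"
    using assms by (auto simp: d_f split: if_splits)
next
  assume "j = j' \<and> (i = i' \<or> j = 0)"
  then show "f i j = f i' j'" using assms by (intro d_zero) (auto simp: d_f)
qed

lemma finite_V [simp]: "finite V"
proof -
  have "V = (\<Union>i\<in>{1..k}. f i ` {..l i})" unfolding V_def by blast
  then show ?thesis by simp
qed

lemma body: "i \<in> {1..k} \<Longrightarrow> f i 0 = f 1 0"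
  using f_eq[of i 1 0 0] k_ge by auto

lemma consistent_atD:
  "consistent_at c u \<Longrightarrow> v \<in> V \<Longrightarrow> v' \<in> V \<Longrightarrow> d u v < d u v' \<Longrightarrow> \<bar>c u - c v\<bar> \<le> \<bar>c u - c v'\<bar>"
  unfolding consistent_at_def by blast

lemma consistent_at_uminus [simp]: "consistent_at (\<lambda>v. - c v) u \<longleftrightarrow> consistent_at c u"
proof -
  have "\<bar>- c u - - c v\<bar> = \<bar>c u - c v\<bar>" for v by linarith
  then show ?thesis unfolding consistent_at_def by simp
qed

lemma interval_labeling_uminus: "interval_labeling c \<Longrightarrow> interval_labeling (\<lambda>v. - c v)"
proof -
  assume "interval_labeling c"
  then obtain A B where i: "inj_on c V" and e: "c ` V = {A..B}" unfolding interval_labeling_def by blast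
  have "(\<lambda>v. - c v) ` V = uminus ` (c ` V)" by (simp add: image_image)
  also have "\<dots> = {-B..-A}" unfolding e by simp
  finally show "interval_labeling (\<lambda>v. - c v)" using i unfolding interval_labeling_def inj_on_def by auto
qed

section \<open>Labels along a geodesic between two consistent vertices\<close>

lemma label_neq: "interval_labeling c \<Longrightarrow> u \<in> V \<Longrightarrow> v \<in> V \<Longrightarrow> u \<noteq> v \<Longrightarrow> c u \<noteq> c v"
  unfolding interval_labeling_def inj_on_def by blast

lemma label_attained:
  assumes "interval_labeling c" "u \<in> V" "v \<in> V" "c u \<le> t" "t \<le> c v"
  obtains z where "z \<in> V" "c z = t"
proof -
  obtain A B where e: "c ` V = {A..B}" using assms(1) unfolding interval_labeling_def by blast
  have "c u \<in> {A..B}" "c v \<in> {A..B}" using assms e by blast+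
  then have "t \<in> c ` V" unfolding e using assms by auto
  then show ?thesis using that by blast
qed

text \<open>The path \<open>g\<close> is abstract so that the result serves segments of one leg and
  paths through the body alike. In a tree the sum \<open>d u z + d v z\<close> exceeds
  \<open>D\<close> by twice the distance of \<open>z\<close> from the geodesic; hence
  \<open>btw\<close> can afford the bound \<open>D + 1\<close>, which is what a vertex squeezed
  between \<open>g i\<close> and \<open>g (Suc i)\<close> satisfies:
  \<open>(i + 1) + (D - i)\<close>.\<close>

lemma geodesic_ordered:
  assumes c: "interval_labeling c" and u: "consistent_at c (g 0)" and v: "consistent_at c (g D)"
    and gV: "\<And>i. i \<le> D \<Longrightarrow> g i \<in> V"
    and du: "\<And>i. i \<le> D \<Longrightarrow> d (g 0) (g i) = i"
    and dv: "\<And>i. i \<le> D \<Longrightarrow> d (g D) (g i) = D - i"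
    and btw: "\<And>z. z \<in> V \<Longrightarrow> d (g 0) z + d (g D) z \<le> D + 1 \<Longrightarrow> z \<in> g ` {..D}"
    and le: "c (g 0) \<le> c (g D)"
  shows "i \<le> D \<Longrightarrow> c (g i) = c (g 0) + int i"
proof -
  have range: "c (g 0) \<le> c (g i) \<and> c (g i) \<le> c (g D)" if "i \<le> D" for i
  proof (cases "i = 0 \<or> i = D")
    case True then show ?thesis using le by auto
  next
    case False
    then have "d (g 0) (g i) < d (g 0) (g D)" "d (g D) (g i) < d (g D) (g 0)"
      using that du[of i] du[of D] dv[of i] dv[of 0] by auto
    then have "\<bar>c (g 0) - c (g i)\<bar> \<le> \<bar>c (g 0) - c (g D)\<bar>"
      "\<bar>c (g D) - c (g i)\<bar> \<le> \<bar>c (g D) - c (g 0)\<bar>"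
      using consistent_atD[OF u gV gV] consistent_atD[OF v gV gV] that by auto
    then show ?thesis using le by linarith
  qed
  have smono: "c (g i) < c (g j)" if "i < j" "j \<le> D" for i j
  proof -
    have "d (g 0) (g i) < d (g 0) (g j)" using du[of i] du[of j] that by auto
    then have "\<bar>c (g 0) - c (g i)\<bar> \<le> \<bar>c (g 0) - c (g j)\<bar>" "g i \<noteq> g j"
      using consistent_atD[OF u gV gV] that by auto
    moreover have "c (g i) \<noteq> c (g j)" using label_neq[OF c gV gV \<open>g i \<noteq> g j\<close>] that by auto
    ultimately show ?thesis using range[of i] range[of j] that by auto
  qed
  have mono: "c (g i) \<le> c (g j)" if "i \<le> j" "j \<le> D" for i j
    using smono[of i j] that by (cases "i = j") auto
  have step: "c (g (Suc i)) = c (g i) + 1" if i: "i < D" for i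
  proof (rule ccontr)
    assume "c (g (Suc i)) \<noteq> c (g i) + 1"
    then have gap: "c (g i) + 1 < c (g (Suc i))" using smono[of i "Suc i"] i by auto
    obtain z where z: "z \<in> V" "c z = c (g i) + 1"
      using label_attained[OF c gV[of i] gV[of "Suc i"], of "c (g i) + 1"] i gap by auto
    \<comment> \<open>The label of \<open>z\<close> lies strictly between those of
      \<open>g i\<close> and \<open>g (Suc i)\<close>, so \<open>z\<close> can be farther than
      \<open>g (Suc i)\<close> from neither \<open>g 0\<close> nor, symmetrically, farther than
      \<open>g i\<close> from \<open>g D\<close>.\<close>
    have "d (g 0) z \<le> i + 1"
    proof (rule ccontr)
      assume "\<not> d (g 0) z \<le> i + 1"
      then have "\<bar>c (g 0) - c (g (Suc i))\<bar> \<le> \<bar>c (g 0) - c z\<bar>"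
        using consistent_atD[OF u gV[of "Suc i"] z(1)] du[of "Suc i"] i by auto
      then show False using range[of "Suc i"] range[of i] i z gap by auto
    qed
    moreover have "d (g D) z \<le> D - i"
    proof (rule ccontr)
      assume "\<not> d (g D) z \<le> D - i"
      then have "\<bar>c (g D) - c (g i)\<bar> \<le> \<bar>c (g D) - c z\<bar>"
        using consistent_atD[OF v gV[of i] z(1)] dv[of i] i by auto
      then show False using range[of "Suc i"] range[of i] i z gap by auto
    qed
    ultimately have "d (g 0) z + d (g D) z \<le> D + 1" using i by auto
    then obtain m where m: "z = g m" "m \<le> D" using btw z by auto
    show False
    proof (cases "m \<le> i")
      case True then show False using mono[of m i] i z m by auto
    next
      case False then show False using mono[of "Suc i" m] m z gap by auto
    qed
  qed
  show "i \<le> D \<Longrightarrow> c (g i) = c (g 0) + int i"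
    by (induction i) (use step in auto)
qed

lemma geodesic_consecutive:
  assumes c: "interval_labeling c" and u: "consistent_at c (g 0)" and v: "consistent_at c (g D)"
    and gV: "\<And>i. i \<le> D \<Longrightarrow> g i \<in> V"
    and du: "\<And>i. i \<le> D \<Longrightarrow> d (g 0) (g i) = i"
    and dv: "\<And>i. i \<le> D \<Longrightarrow> d (g D) (g i) = D - i"
    and btw: "\<And>z. z \<in> V \<Longrightarrow> d (g 0) z + d (g D) z \<le> D + 1 \<Longrightarrow> z \<in> g ` {..D}"
  shows "(\<forall>i\<le>D. c (g i) = c (g 0) + int i) \<or> (\<forall>i\<le>D. c (g i) = c (g 0) - int i)"
proof (cases "c (g 0) \<le> c (g D)")
  case True
  have "c (g i) = c (g 0) + int i" if "i \<le> D" for i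
    by (rule geodesic_ordered[OF c, of g D i]) (use True u v gV du dv btw that in auto)
  then show ?thesis by blast
next
  case False
  have "- c (g i) = - c (g 0) + int i" if "i \<le> D" for i
    by (rule geodesic_ordered[OF interval_labeling_uminus[OF c], of g D i])
       (use False u v gV du dv btw that in auto)
  then have "c (g i) = c (g 0) - int i" if "i \<le> D" for i using that by force
  then show ?thesis by blast
qed

lemma leg_consecutive:
  assumes c: "interval_labeling c" and b: "b \<in> {1..k}" and q: "p \<le> q" "q \<le> l b"
    and cp: "consistent_at c (f b p)" and cq: "consistent_at c (f b q)"
  shows "\<exists>s\<in>{1, -1}. \<exists>X. \<forall>j. p \<le> j \<and> j \<le> q \<longrightarrow> c (f b j) = X + s * int j"
proof -
  define g where "g i = f b (p + i)" for i
  have "(\<forall>i\<le>q - p. c (g i) = c (g 0) + int i) \<or> (\<forall>i\<le>q - p. c (g i) = c (g 0) - int i)"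
  proof (rule geodesic_consecutive[OF c])
    show "consistent_at c (g 0)" "consistent_at c (g (q - p))" using cp cq q unfolding g_def by auto
    fix z assume z: "z \<in> V" "d (g 0) z + d (g (q - p)) z \<le> q - p + 1"
    obtain i j where ij: "i \<in> {1..k}" "j \<le> l i" "z = f i j" using V_cases[OF z(1)] .
    show "z \<in> g ` {..q - p}"
    proof (cases "i = b")
      case True
      then have "p \<le> j" "j \<le> q" using z b q ij unfolding g_def by (auto simp: d_same split: if_splits)
      then show ?thesis using ij True unfolding g_def by (intro image_eqI[of _ _ "j - p"]) auto
    next
      case False
      then have "p = 0" "j = 0" using z b q ij unfolding g_def by (auto simp: d_diff split: if_splits)
      then have "z = g 0" using body[OF ij(1)] body[OF b] ij unfolding g_def by auto
      then show ?thesis by auto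
    qed
  qed (use b q in \<open>auto simp: g_def d_same\<close>)
  then have "\<exists>s\<in>{1, -1}. \<forall>i\<le>q - p. c (g i) = c (g 0) + s * int i"
    by (auto simp del: of_nat_diff)
  then obtain s :: int where s: "s \<in> {1, -1}" "\<forall>i\<le>q - p. c (g i) = c (g 0) + s * int i" by blast
  have "c (f b j) = (c (g 0) - s * int p) + s * int j" if "p \<le> j \<and> j \<le> q" for j
  proof -
    have "c (f b j) = c (g 0) + s * int (j - p)"
      using s(2)[rule_format, of "j - p"] diff_le_mono[of j q p] that unfolding g_def by simp
    then show ?thesis using that by (simp add: of_nat_diff algebra_simps)
  qed
  then show ?thesis using s(1) by blast
qed

text \<open>Depth increases away from the body on both legs, so one monotone run of labels through
  the body appears with opposite signs; \<open>X\<close> is the label of the body.\<close>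

lemma cross_consecutive:
  assumes c: "interval_labeling c" and a: "a \<in> {1..k}" and b: "b \<in> {1..k}" "a \<noteq> b"
    and pq: "p \<le> l a" "q \<le> l b"
    and cp: "consistent_at c (f a p)" and cq: "consistent_at c (f b q)"
  shows "\<exists>s\<in>{1, -1}. \<exists>X. (\<forall>j\<le>p. c (f a j) = X - s * int j) \<and> (\<forall>j\<le>q. c (f b j) = X + s * int j)"
proof -
  define g where "g i = (if i \<le> p then f a (p - i) else f b (i - p))" for i
  have g0: "g 0 = f a p" unfolding g_def by simp
  have gD: "g (p + q) = f b q" unfolding g_def using body[OF a] body[OF b(1)] by auto
  have gb: "g (p + i) = f b i" for i unfolding g_def using body[OF a] body[OF b(1)] by auto
  have "(\<forall>i\<le>p + q. c (g i) = c (g 0) + int i) \<or> (\<forall>i\<le>p + q. c (g i) = c (g 0) - int i)"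
  proof (rule geodesic_consecutive[OF c])
    show "consistent_at c (g 0)" "consistent_at c (g (p + q))" using cp cq g0 gD by auto
    fix z assume z: "z \<in> V" "d (g 0) z + d (g (p + q)) z \<le> p + q + 1"
    obtain i j where ij: "i \<in> {1..k}" "j \<le> l i" "z = f i j" using V_cases[OF z(1)] .
    consider "i = a" | "i = b" | "i \<noteq> a" "i \<noteq> b" by blast
    then show "z \<in> g ` {..p + q}"
    proof cases
      case 1
      then have "j \<le> p" using z a b pq ij unfolding g0 gD by (auto simp: d_same d_diff split: if_splits)
      then show ?thesis using ij 1 unfolding g_def by (intro image_eqI[of _ _ "p - j"]) auto
    next
      case 2
      then have "j \<le> q" using z a b pq ij unfolding g0 gD by (auto simp: d_same d_diff split: if_splits)
      then show ?thesis using ij 2 gb by (intro image_eqI[of _ _ "p + j"]) auto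
    next
      case 3
      then have "j = 0" using z a b pq ij unfolding g0 gD by (auto simp: d_same d_diff split: if_splits)
      then have "z = g p" using body[OF ij(1)] body[OF a] ij unfolding g_def by auto
      then show ?thesis by auto
    qed
  qed (use a b pq in \<open>auto simp: gD g_def d_same d_diff\<close>)
  then have "\<exists>s\<in>{1, -1}. \<forall>i\<le>p + q. c (g i) = c (g 0) + s * int i"
    by (auto simp del: of_nat_add)
  then obtain s :: int where s: "s \<in> {1, -1}" "\<forall>i\<le>p + q. c (g i) = c (g 0) + s * int i" by blast
  have ga: "g (p - j) = f a j" if "j \<le> p" for j using that unfolding g_def by simp
  have "c (f a j) = c (g 0) + s * int p - s * int j" if "j \<le> p" for j
  proof -
    have "c (f a j) = c (g 0) + s * int (p - j)"
      using s(2)[rule_format, of "p - j"] that ga[of j] by auto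
    then show ?thesis using that by (simp add: of_nat_diff algebra_simps)
  qed
  moreover have "c (f b j) = c (g 0) + s * int p + s * int j" if "j \<le> q" for j
    using s(2)[rule_format, of "p + j"] gb[of j] that by (simp add: algebra_simps)
  ultimately show ?thesis using s(1) by blast
qed

section \<open>Counting labels of balls around consistent vertices\<close>

text \<open>Vertices nearer to \<open>u\<close> than \<open>z\<close> have labels within
  \<open>m\<close> of \<open>c u\<close>, and of these \<open>2 * m + 1\<close> labels
  \<open>c u - m\<close> is taken by \<open>z\<close> itself.\<close>

lemma ball_upper:
  assumes c: "interval_labeling c" and u: "consistent_at c u" and z: "z \<in> V" "c z = c u - m" "0 \<le> m"
    and B: "B \<subseteq> V" "\<And>x. x \<in> B \<Longrightarrow> d u x < d u z"
  shows "c ` B \<subseteq> {c u - m + 1..c u + m}" "int (card B) \<le> 2 * m"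
proof -
  show s: "c ` B \<subseteq> {c u - m + 1..c u + m}"
  proof
    fix t assume "t \<in> c ` B"
    then obtain x where x: "x \<in> B" "t = c x" by auto
    have "\<bar>c u - c x\<bar> \<le> \<bar>c u - c z\<bar>" by (rule consistent_atD[OF u]) (use x B z in auto)
    moreover have "c x \<noteq> c z" using label_neq[OF c, of x z] x B z by blast
    ultimately show "t \<in> {c u - m + 1..c u + m}" using x z by auto
  qed
  have "inj_on c B" using c B(1) unfolding interval_labeling_def by (blast intro: inj_on_subset)
  then have "card B = card (c ` B)" by (simp add: card_image)
  also have "\<dots> \<le> card {c u - m + 1..c u + m}" by (rule card_mono) (use s in auto)
  finally show "int (card B) \<le> 2 * m" using z by auto
qed

text \<open>A label less than \<open>m\<close> away from \<open>c u\<close> cannot belong to a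
  vertex farther than \<open>z\<close>. The upper end stops at \<open>c u + m - 1\<close> because
  consistency permits ties, so \<open>c u + m\<close> may lie outside the ball;
  \<open>c u - m\<close> is safe, being the label of \<open>z\<close>. The vertex \<open>a\<close>
  guarantees that the labels up to this end are in use.\<close>

lemma ball_lower:
  assumes c: "interval_labeling c" and u: "consistent_at c u" and z: "z \<in> V" "c z = c u - m"
    and a: "a \<in> V" "c u + m - 1 \<le> c a"
  shows "{c u - m..c u + m - 1} \<subseteq> c ` {x \<in> V. d u x \<le> d u z}"
    and "2 * m \<le> int (card {x \<in> V. d u x \<le> d u z})"
proof -
  show s: "{c u - m..c u + m - 1} \<subseteq> c ` {x \<in> V. d u x \<le> d u z}"
  proof
    fix t assume t: "t \<in> {c u - m..c u + m - 1}"
    then obtain x where x: "x \<in> V" "c x = t"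
      using label_attained[OF c z(1) a(1), of t] z a by auto
    have "d u x \<le> d u z"
    proof (rule ccontr)
      assume n: "\<not> d u x \<le> d u z"
      then have "\<bar>c u - c z\<bar> \<le> \<bar>c u - c x\<bar>" using consistent_atD[OF u z(1) x(1)] by auto
      then have "c x = c z" using t x z by auto
      then show False using label_neq[OF c x(1) z(1)] n by blast
    qed
    then show "t \<in> c ` {x \<in> V. d u x \<le> d u z}" using x by blast
  qed
  have "card {c u - m..c u + m - 1} \<le> card (c ` {x \<in> V. d u x \<le> d u z})"
    by (rule card_mono) (use s in auto)
  also have "\<dots> \<le> card {x \<in> V. d u x \<le> d u z}" by (rule card_image_le) auto
  finally show "2 * m \<le> int (card {x \<in> V. d u x \<le> d u z})" by auto
qed

text \<open>\<open>f b p\<close> ranks \<open>a\<close> before \<open>f b t\<close> and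
  \<open>f b q\<close> ranks them the other way round. Since \<open>f b q\<close> has the smaller
  label, \<open>f b t\<close> must lie below \<open>f b p\<close>, and \<open>a\<close> at or above
  the mirror image of \<open>f b t\<close> at \<open>f b q\<close>. The second fact supplies the
  vertex \<open>a\<close> required by \<open>ball_lower\<close> around \<open>f b q\<close>.\<close>

lemma far_side:
  assumes c: "interval_labeling c" and b: "b \<in> {1..k}" and pq: "p < q" "q \<le> l b"
    and cp: "consistent_at c (f b p)" and cq: "consistent_at c (f b q)"
    and out: "c (f b q) = c (f b p) - int (q - p)"
    and t: "p < t" "t \<le> l b"
    and a: "a \<in> V" "d (f b p) a < d (f b p) (f b t)" "d (f b q) (f b t) < d (f b q) a"
  shows "c (f b t) < c (f b p)" "2 * c (f b q) - c (f b t) \<le> c a"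
proof -
  have V: "f b p \<in> V" "f b q \<in> V" "f b t \<in> V" using b pq t by auto
  have "\<bar>c (f b p) - c a\<bar> \<le> \<bar>c (f b p) - c (f b t)\<bar>" by (rule consistent_atD[OF cp a(1) V(3) a(2)])
  moreover have "\<bar>c (f b q) - c (f b t)\<bar> \<le> \<bar>c (f b q) - c a\<bar>" by (rule consistent_atD[OF cq V(3) a(1) a(3)])
  moreover have "c a \<noteq> c (f b t)" using label_neq[OF c a(1) V(3)] a(2) by blast
  moreover have "c (f b t) \<noteq> c (f b p)" using label_neq[OF c V(3) V(1)] f_eq[OF b b, of t p] t pq by auto
  moreover have "c (f b q) < c (f b p)" using out pq by simp
  ultimately show "c (f b t) < c (f b p)" "2 * c (f b q) - c (f b t) \<le> c a" by linarith+
qed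

text \<open>The body is at distance \<open>q >= r\<close>, so the ball enters no other leg. Depths
  beyond \<open>l b\<close> in the covering image do no harm to an upper bound.\<close>

lemma ball_in_leg:
  assumes b: "b \<in> {1..k}" and q: "q \<le> l b" "r \<le> q"
  shows "int (card {x \<in> V. d (f b q) x \<le> r}) \<le> 2 * int r + 1"
proof -
  have "{x \<in> V. d (f b q) x \<le> r} \<subseteq> f b ` {q - r..q + r}"
  proof
    fix x assume x: "x \<in> {x \<in> V. d (f b q) x \<le> r}"
    then obtain i j where ij: "i \<in> {1..k}" "j \<le> l i" "x = f i j" using V_cases by blast
    show "x \<in> f b ` {q - r..q + r}"
    proof (cases "i = b")
      case True
      then have "(q - j) + (j - q) \<le> r" using x ij q by (simp add: d_f)
      then have "j \<in> {q - r..q + r}" by auto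
      then show ?thesis using True ij by blast
    next
      case False
      then have "q + j \<le> r" using x ij q b by (simp add: d_diff)
      then have "j = 0" "0 \<in> {q - r..q + r}" using q by auto
      then show ?thesis using body[OF b] body[OF ij(1)] ij by force
    qed
  qed
  then have "card {x \<in> V. d (f b q) x \<le> r} \<le> card (f b ` {q - r..q + r})"
    by (intro card_mono) auto
  also have "\<dots> \<le> card {q - r..q + r}" by (rule card_image_le) auto
  finally show ?thesis using q by auto
qed

text \<open>Labels cannot drop faster than depth grows. Up to \<open>q\<close> they are consecutive;
  beyond \<open>q\<close>, the bound \<open>t <= 2 * q\<close> keeps the ball of radius
  \<open>t - q\<close> around \<open>f b q\<close> inside the leg, and its
  \<open>2 * (t - q) + 1\<close> vertices must account for \<open>2 * m\<close> labels.\<close>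

lemma far_side_bound:
  assumes c: "interval_labeling c" and b: "b \<in> {1..k}" and pq: "p < q" "q \<le> l b"
    and cp: "consistent_at c (f b p)" and cq: "consistent_at c (f b q)"
    and out: "c (f b q) = c (f b p) - int (q - p)"
    and t: "p < t" "t \<le> l b" "t \<le> 2 * q"
    and a: "a \<in> V" "d (f b p) a < d (f b p) (f b t)" "d (f b q) (f b t) < d (f b q) a"
  shows "c (f b p) - c (f b t) \<le> int (t - p)"
proof -
  have con: "c (f b j) = c (f b p) - int (j - p)" if "p \<le> j" "j \<le> q" for j
  proof -
    obtain s X where s: "s \<in> {1, -1}" "\<forall>j. p \<le> j \<and> j \<le> q \<longrightarrow> c (f b j) = X + s * int j"
      using leg_consecutive[OF c b less_imp_le[OF pq(1)] pq(2) cp cq] by blast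
    then have "c (f b p) = X + s * int p" "c (f b q) = X + s * int q" "c (f b j) = X + s * int j"
      using pq that by simp_all
    then show ?thesis using s(1) out pq that by (auto simp: of_nat_diff)
  qed
  note fs = far_side[OF c b pq cp cq out t(1,2) a]
  show ?thesis
  proof (cases "t \<le> q")
    case True then show ?thesis using con[of t] t by simp
  next
    case False
    \<comment> \<open>All labels from \<open>c (f b q)\<close> to \<open>c (f b p)\<close> are taken
      by the segment between them, so \<open>f b t\<close> lies below both.\<close>
    have zq: "c (f b t) < c (f b q)"
    proof (rule ccontr)
      assume n: "\<not> c (f b t) < c (f b q)"
      define j where "j = p + nat (c (f b p) - c (f b t))"
      have j: "p \<le> j" "j \<le> q" "c (f b j) = c (f b t)"
        using con[of j] n fs out pq unfolding j_def by auto
      then show False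
        using label_neq[OF c, of "f b j" "f b t"] f_eq[OF b b, of j t] b pq t False by auto
    qed
    define m where "m = c (f b q) - c (f b t)"
    have dt: "d (f b q) (f b t) = t - q" using b pq t False by (simp add: d_f)
    have "2 * m \<le> int (card {x \<in> V. d (f b q) x \<le> d (f b q) (f b t)})"
      by (rule ball_lower(2)[OF c cq _ _ a(1)]) (use b t fs m_def in auto)
    also have "\<dots> \<le> 2 * int (t - q) + 1" unfolding dt
      by (rule ball_in_leg) (use b pq t in auto)
    finally have "m \<le> int (t - q)" by linarith
    then show ?thesis using m_def out pq t False by (simp add: of_nat_diff)
  qed
qed

section \<open>Two consistent vertices on one leg\<close>

definition nbs :: "nat \<Rightarrow> nat \<Rightarrow> 'a set" where
  "nbs b j = (\<lambda>i. f i j) ` ({1..k} - {b})"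

lemma nbs_subset: "(\<And>i. i \<in> {1..k} \<Longrightarrow> i \<noteq> b \<Longrightarrow> j \<le> l i) \<Longrightarrow> nbs b j \<subseteq> V"
  unfolding nbs_def by blast

lemma card_nbs:
  assumes "b \<in> {1..k}" "1 \<le> j" "\<And>i. i \<in> {1..k} \<Longrightarrow> i \<noteq> b \<Longrightarrow> j \<le> l i"
  shows "card (nbs b j) = k - 1"
proof -
  have "inj_on (\<lambda>i. f i j) ({1..k} - {b})"
  proof (rule inj_onI)
    fix i i' assume "i \<in> {1..k} - {b}" "i' \<in> {1..k} - {b}" "f i j = f i' j"
    then show "i = i'" using f_eq[of i i' j j] assms by auto
  qed
  then show ?thesis unfolding nbs_def using assms by (simp add: card_image)
qed

lemma card_leg:
  assumes "b \<in> {1..k}" "r \<le> l b" shows "card (f b ` {0..r}) = r + 1"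
proof -
  have "inj_on (f b) {0..r}"
  proof (rule inj_onI)
    fix i i' assume "i \<in> {0..r}" "i' \<in> {0..r}" "f b i = f b i'"
    then show "i = i'" using f_eq[of b b i i'] assms by auto
  qed
  then show ?thesis by (simp add: card_image)
qed

lemma leg_nbs_disjoint:
  assumes "b \<in> {1..k}" "r \<le> l b" "1 \<le> j" "\<And>i. i \<in> {1..k} \<Longrightarrow> i \<noteq> b \<Longrightarrow> j \<le> l i"
  shows "f b ` {0..r} \<inter> nbs b j = {}"
proof -
  have "f b i \<noteq> f i' j" if "i \<le> r" "i' \<in> {1..k}" "i' \<noteq> b" for i i'
    using f_eq[OF assms(1) that(2), of i j] that assms by auto
  then have "x \<noteq> y" if "x \<in> f b ` {0..r}" "y \<in> nbs b j" for x y
    using that unfolding nbs_def by force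
  then show ?thesis by blast
qed

lemma card_leg_nbs:
  assumes "b \<in> {1..k}" "r \<le> l b"
  shows "card (f b ` {0..r} \<union> nbs b 1) = r + k"
proof -
  have "card (f b ` {0..r} \<union> nbs b 1) = card (f b ` {0..r}) + card (nbs b 1)"
    by (rule card_Un_disjoint[OF _ _ leg_nbs_disjoint[OF assms]]) (use l_pos in \<open>auto simp: nbs_def\<close>)
  also have "\<dots> = r + 1 + (k - 1)" using card_leg[OF assms] card_nbs[OF assms(1), of 1] l_pos by simp
  finally show ?thesis using k_ge by simp
qed

lemma card_leg_nbs2:
  assumes "b \<in> {1..k}" "r \<le> l b" and 2: "\<And>i. i \<in> {1..k} \<Longrightarrow> 2 \<le> l i"
  shows "card (f b ` {0..r} \<union> nbs b 1 \<union> nbs b 2) = r + 2 * k - 1"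
proof -
  have "f i 1 \<noteq> f i' 2" if "i \<in> {1..k}" "i' \<in> {1..k}" for i i'
    using f_eq[OF that, of 1 2] l_pos[OF that(1)] 2[OF that(2)] by simp
  then have "nbs b 1 \<inter> nbs b 2 = {}" unfolding nbs_def by blast
  then have "(f b ` {0..r} \<union> nbs b 1) \<inter> nbs b 2 = {}"
    using leg_nbs_disjoint[OF assms(1,2), of 2] 2 by auto
  then have "card (f b ` {0..r} \<union> nbs b 1 \<union> nbs b 2) = (r + k) + (k - 1)"
    using card_Un_disjoint[of "f b ` {0..r} \<union> nbs b 1" "nbs b 2"] card_leg_nbs[OF assms(1,2)]
      card_nbs[OF assms(1), of 2] 2 by (simp add: nbs_def)
  then show ?thesis using k_ge by simp
qed

lemma other_leg:
  assumes "b \<in> {1..k}" obtains i where "i \<in> {1..k}" "i \<noteq> b"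
proof (cases "b = 1")
  case True then show ?thesis using that[of 2] k_ge by simp
next
  case False then show ?thesis using that[of 1] k_ge by simp
qed

lemma third_leg:
  assumes "a \<in> {1..k}" "b \<in> {1..k}" obtains i where "i \<in> {1..k}" "i \<noteq> a" "i \<noteq> b"
proof -
  consider "1 \<noteq> a \<and> 1 \<noteq> b" | "2 \<noteq> a \<and> 2 \<noteq> b" | "3 \<noteq> a \<and> 3 \<noteq> b" by arith
  then show ?thesis using that[of 1] that[of 2] that[of 3] k_ge by cases simp_all
qed

text \<open>The neighbours of the body on other legs are at distance \<open>p + 1\<close> from
  \<open>f b p\<close>, just inside \<open>f b (2 * p + 2)\<close> at distance \<open>p + 2\<close>.
  From \<open>f b q\<close> the order is reversed because \<open>q > p\<close>, so
  \<open>far_side\<close> applies with such a neighbour as \<open>a\<close>. The counted set has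
  \<open>2 * p + 2\<close> vertices on leg \<open>b\<close> and \<open>k - 1\<close> off it.\<close>

lemma inner_step:
  assumes c: "interval_labeling c" and b: "b \<in> {1..k}" and pq: "p < q" "q \<le> l b"
    and cp: "consistent_at c (f b p)" and cq: "consistent_at c (f b q)"
    and out: "c (f b q) = c (f b p) - int (q - p)"
    and t: "2 * p + 2 \<le> l b"
  shows "c (f b p) - c (f b (2 * p + 2)) \<le> int p + 2"
    "c (f b (2 * p + 2)) < c (f b p)"
    "c ` (f b ` {0..2 * p + 1} \<union> nbs b 1) \<subseteq> {c (f b (2 * p + 2)) + 1..2 * c (f b p) - c (f b (2 * p + 2))}"
    "2 * int p + 1 + int k \<le> 2 * (c (f b p) - c (f b (2 * p + 2)))"
proof -
  obtain i where i: "i \<in> {1..k}" "i \<noteq> b" using other_leg[OF b] .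
  have V: "f i 1 \<in> V" using i l_pos by auto
  have dp: "d (f b p) (f b (2 * p + 2)) = p + 2" using b t by (simp add: d_f)
  have a: "d (f b p) (f i 1) < d (f b p) (f b (2 * p + 2))"
    "d (f b q) (f b (2 * p + 2)) < d (f b q) (f i 1)"
    using i b t pq l_pos[OF i(1)] by (auto simp: d_f split: if_splits)
  have t': "p < 2 * p + 2" "2 * p + 2 \<le> 2 * q" using pq by auto
  show "c (f b p) - c (f b (2 * p + 2)) \<le> int p + 2"
    using far_side_bound[OF c b pq cp cq out t'(1) t t'(2) V a] by simp
  show lt: "c (f b (2 * p + 2)) < c (f b p)"
    by (rule far_side(1)[OF c b pq cp cq out t'(1) t V a])
  define m where "m = c (f b p) - c (f b (2 * p + 2))"
  have B: "f b ` {0..2 * p + 1} \<union> nbs b 1 \<subseteq> V"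
    using nbs_subset[of b 1] l_pos b t by auto
  have B': "d (f b p) x < d (f b p) (f b (2 * p + 2))" if "x \<in> f b ` {0..2 * p + 1} \<union> nbs b 1" for x
    using that b t l_pos unfolding dp nbs_def by (auto simp: d_f split: if_splits)
  have zV: "f b (2 * p + 2) \<in> V" using b t by auto
  have m: "c (f b (2 * p + 2)) = c (f b p) - m" "0 \<le> m" using m_def lt by auto
  note bu = ball_upper[OF c cp zV m B B']
  show "c ` (f b ` {0..2 * p + 1} \<union> nbs b 1) \<subseteq> {c (f b (2 * p + 2)) + 1..2 * c (f b p) - c (f b (2 * p + 2))}"
    using bu(1) unfolding m_def by (simp add: algebra_simps)
  have "card (f b ` {0..2 * p + 1} \<union> nbs b 1) = 2 * p + 1 + k"
    by (rule card_leg_nbs) (use b t in auto)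
  then show "2 * int p + 1 + int k \<le> 2 * (c (f b p) - c (f b (2 * p + 2)))"
    using bu(2) unfolding m_def by simp
qed

lemma normalize_leg:
  assumes c: "interval_labeling c" and b: "b \<in> {1..k}" and pq: "p < q" "q \<le> l b"
    and cp: "consistent_at c (f b p)" and cq: "consistent_at c (f b q)"
  obtains c' where "interval_labeling c'" "consistent_at c' (f b p)" "consistent_at c' (f b q)"
    "c' (f b q) = c' (f b p) - int (q - p)"
proof -
  have "c (f b q) = c (f b p) + int (q - p) \<or> c (f b q) = c (f b p) - int (q - p)"
  proof -
    obtain s X where s: "s \<in> {1, -1}" "\<forall>j. p \<le> j \<and> j \<le> q \<longrightarrow> c (f b j) = X + s * int j"
      using leg_consecutive[OF c b less_imp_le[OF pq(1)] pq(2) cp cq] by blast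
    then have "c (f b p) = X + s * int p" "c (f b q) = X + s * int q" using pq by simp_all
    then show ?thesis using s(1) pq by (auto simp: of_nat_diff)
  qed
  then show ?thesis
  proof
    assume "c (f b q) = c (f b p) + int (q - p)"
    then show ?thesis using that[OF interval_labeling_uminus[OF c]] cp cq by simp
  next
    assume "c (f b q) = c (f b p) - int (q - p)"
    then show ?thesis using that[OF c] cp cq by simp
  qed
qed

text \<open>By \<open>inner_step\<close>, \<open>2 * p + 1 + k <= 2 * m\<close> and
  \<open>m <= p + 2\<close>, which forces \<open>k <= 3\<close>.\<close>

lemma inner_unique:
  assumes c: "interval_labeling c" and b: "b \<in> {1..k}" and pq: "p < q" "q \<le> l b"
    and cp: "consistent_at c (f b p)" and cq: "consistent_at c (f b q)" and k: "4 \<le> k"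
  shows "l b < 2 * p + 2"
proof (rule ccontr)
  assume "\<not> l b < 2 * p + 2"
  then have t: "2 * p + 2 \<le> l b" by simp
  obtain c' where c': "interval_labeling c'" "consistent_at c' (f b p)" "consistent_at c' (f b q)"
    "c' (f b q) = c' (f b p) - int (q - p)" using normalize_leg[OF c b pq cp cq] .
  obtain m where "m \<le> int p + 2" "2 * int p + 1 + int k \<le> 2 * m"
    using inner_step(1,4)[OF c'(1) b pq c'(2-4) t] by blast
  then show False using k by linarith
qed

text \<open>For \<open>k = 3\<close> the count at depth \<open>2 * p + 2\<close> is an equality, so
  depth \<open>2 * p + 3\<close> is needed, with depth 2 on the other legs in place of depth 1. The
  ball around \<open>f b p\<close> now has \<open>2 * p + 7\<close> vertices, whence
  \<open>m >= p + 4\<close> by parity. If \<open>q = p + 1\<close>, \<open>far_side_bound\<close> is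
  out of reach and the equality at depth \<open>2 * p + 2\<close> provides the one additional label
  that gives a contradiction.\<close>

lemma inner_unique3:
  assumes c: "interval_labeling c" and b: "b \<in> {1..k}" and pq: "p < q" "q \<le> l b"
    and cp: "consistent_at c (f b p)" and cq: "consistent_at c (f b q)" and k: "k = 3"
    and 2: "\<And>i. i \<in> {1..k} \<Longrightarrow> 2 \<le> l i"
  shows "l b < 2 * p + 3"
proof (rule ccontr)
  assume "\<not> l b < 2 * p + 3"
  then have t: "2 * p + 3 \<le> l b" "2 * p + 2 \<le> l b" by simp_all
  obtain c' where c': "interval_labeling c'" "consistent_at c' (f b p)" "consistent_at c' (f b q)"
    "c' (f b q) = c' (f b p) - int (q - p)" using normalize_leg[OF c b pq cp cq] .
  note st = inner_step[OF c'(1) b pq c'(2-4) t(2)]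
  obtain i where i: "i \<in> {1..k}" "i \<noteq> b" using other_leg[OF b] .
  have V: "f i 2 \<in> V" "f b (2 * p + 3) \<in> V" using i 2 b t by auto
  have dp: "d (f b p) (f b (2 * p + 3)) = p + 3" using b t by (simp add: d_f)
  have a: "d (f b p) (f i 2) < d (f b p) (f b (2 * p + 3))"
    "d (f b q) (f b (2 * p + 3)) < d (f b q) (f i 2)"
    using i b t pq 2[OF i(1)] by (auto simp: d_f split: if_splits)
  have t': "p < 2 * p + 3" by simp
  note fs = far_side[OF c'(1) b pq c'(2-4) t' t(1) V(1) a]
  define m where "m = c' (f b p) - c' (f b (2 * p + 3))"
  let ?B = "f b ` {0..2 * p + 2} \<union> nbs b 1 \<union> nbs b 2"
  have B: "?B \<subseteq> V"
    using nbs_subset[of b 1] nbs_subset[of b 2] 2 l_pos b t by auto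
  have B': "d (f b p) x < d (f b p) (f b (2 * p + 3))" if "x \<in> ?B" for x
    using that b t 2 l_pos unfolding dp nbs_def by (auto simp: d_f split: if_splits)
  have "int (card ?B) \<le> 2 * m"
    by (rule ball_upper(2)[OF c'(1,2) V(2) _ _ B B']) (use fs m_def in auto)
  moreover have "card ?B = 2 * p + 2 + 2 * k - 1"
    by (rule card_leg_nbs2) (use b t 2 in auto)
  ultimately have m: "int p + 4 \<le> m" using k by simp
  show False
  proof (cases "q = p + 1")
    case False
    then have "m \<le> int p + 3"
      using far_side_bound[OF c'(1) b pq c'(2-4) t' t(1) _ V(1) a] pq m_def by simp
    then show False using m by simp
  next
    case True
    let ?x = "c' (f b p)"
    \<comment> \<open>Both estimates of \<open>inner_step\<close> meet at \<open>p + 2\<close> when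
      \<open>k = 3\<close>.\<close>
    have z2: "c' (f b (2 * p + 2)) = ?x - int p - 2" using st k by simp
    let ?C = "f b ` {0..2 * p + 1} \<union> nbs b 1"
    have CV: "?C \<subseteq> V" using B by auto
    \<comment> \<open>The \<open>2 * p + 4\<close> vertices of \<open>?C\<close> have exactly
      \<open>2 * p + 4\<close> labels available, so the topmost one is used.\<close>
    have "?x + int p + 2 \<in> c' ` ?C"
    proof (rule ccontr)
      assume n: "?x + int p + 2 \<notin> c' ` ?C"
      have "c' ` ?C \<subseteq> {?x - int p - 1..?x + int p + 1}"
      proof
        fix y assume y: "y \<in> c' ` ?C"
        then have "y \<in> {?x - int p - 1..?x + int p + 2}" using subsetD[OF st(3) y] unfolding z2 by simp
        moreover have "y \<noteq> ?x + int p + 2" using y n by blast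
        ultimately show "y \<in> {?x - int p - 1..?x + int p + 1}" by auto
      qed
      then have "card (c' ` ?C) \<le> card {?x - int p - 1..?x + int p + 1}"
        by (intro card_mono) auto
      moreover have "card (c' ` ?C) = card ?C"
        using c'(1) unfolding interval_labeling_def by (intro card_image inj_on_subset[OF _ CV]) simp
      moreover have "card ?C = 2 * p + 1 + k"
        by (rule card_leg_nbs) (use b t in auto)
      ultimately show False using k by simp
    qed
    then obtain g where g: "g \<in> ?C" "c' g = ?x + int p + 2" by (metis imageE)
    let ?D = "{x \<in> V. d (f b q) x \<le> d (f b q) (f b (2 * p + 3))}"
    have dq: "d (f b q) (f b (2 * p + 3)) = p + 2" using d_f[OF b b pq(2) t(1)] True by simp
    consider j where "j \<le> 2 * p + 1" "g = f b j" | i' where "i' \<in> {1..k}" "i' \<noteq> b" "g = f i' 1"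
      using g(1) unfolding nbs_def atLeast0AtMost by blast
    then have "d (f b q) g \<le> p + 2"
    proof cases
      case 1
      have "j \<le> l b" using 1 t by simp
      then show ?thesis using 1 b pq d_f[OF b b, of q j] True by simp
    next
      case 2
      then show ?thesis using d_f[OF b 2(1), of q 1] pq l_pos True by simp
    qed
    then have gD: "g \<in> ?D" using g(1) CV dq by auto
    have q: "c' (f b q) = ?x - 1" using c'(4) True by simp
    \<comment> \<open>\<open>ball_lower\<close> around \<open>f b q\<close>, whose label is
      \<open>?x - 1\<close>: radius \<open>m - 1\<close> there reaches down to
      \<open>?x - m\<close>, but up only to \<open>?x + m - 3\<close>.\<close>
    have sub: "{?x - m..?x + m - 3} \<subseteq> c' ` ?D"
      using ball_lower(1)[OF c'(1,3) V(2), of "m - 1" "f i 2"] fs V(1) m unfolding q m_def by simp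
    have "?D \<subseteq> f b ` {0..2 * p + 3} \<union> nbs b 1"
    proof
      fix x assume x: "x \<in> ?D"
      then obtain i' j where ij: "i' \<in> {1..k}" "j \<le> l i'" "x = f i' j" using V_cases by blast
      show "x \<in> f b ` {0..2 * p + 3} \<union> nbs b 1"
      proof (cases "i' = b")
        case True
        then have "(q - j) + (j - q) \<le> p + 2" using x ij(2,3) d_f[OF b b pq(2), of j] dq by simp
        then have "j \<in> {0..2 * p + 3}" using \<open>q = p + 1\<close> by simp
        then show ?thesis using True ij(3) by blast
      next
        case False
        then have "j \<le> 1" using x ij(2,3) d_f[OF b ij(1) pq(2), of j] \<open>q = p + 1\<close> dq by simp
        then have "j = 0 \<or> j = 1" by auto
        then show ?thesis
        proof
          assume "j = 0"
          then have "x = f b 0" using body[OF b] body[OF ij(1)] ij(3) by simp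
          moreover have "0 \<in> {0..2 * p + 3}" by simp
          ultimately show ?thesis by blast
        next
          assume "j = 1"
          then show ?thesis using ij(1,3) False unfolding nbs_def by blast
        qed
      qed
    qed
    then have "card ?D \<le> card (f b ` {0..2 * p + 3} \<union> nbs b 1)"
      by (intro card_mono) (auto simp: nbs_def)
    also have "\<dots> = 2 * p + 3 + k" by (rule card_leg_nbs) (use b t in auto)
    finally have cD: "card ?D \<le> 2 * p + 6" using k by simp
    \<comment> \<open>Since \<open>m >= p + 4\<close>, \<open>sub\<close> covers everything but
      possibly the last label, which \<open>g\<close> supplies. These are \<open>2 * p + 7\<close>
      labels for at most \<open>2 * p + 6\<close> vertices of \<open>?D\<close>.\<close>
    have "{?x - int p - 4..?x + int p + 2} \<subseteq> c' ` ?D"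
    proof
      fix y assume y: "y \<in> {?x - int p - 4..?x + int p + 2}"
      show "y \<in> c' ` ?D"
      proof (cases "y = ?x + int p + 2")
        case True
        then have "y = c' g" using g(2) by simp
        then show ?thesis using gD by (rule image_eqI)
      next
        case False
        then have "y \<in> {?x - m..?x + m - 3}" using y m by simp
        then show ?thesis using sub by blast
      qed
    qed
    then have "card {?x - int p - 4..?x + int p + 2} \<le> card (c' ` ?D)"
      by (intro card_mono) auto
    also have "\<dots> \<le> card ?D" by (rule card_image_le) auto
    finally show False using cD by simp
  qed
qed

section \<open>Consistent vertices on different legs\<close>

lemma opposite_sides:
  assumes c: "interval_labeling c" and a: "a \<in> {1..k}" and b: "b \<in> {1..k}" "a \<noteq> b"
    and pq: "1 \<le> p" "p \<le> l a" "1 \<le> q" "q \<le> l b"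
    and cp: "consistent_at c (f a p)" and cq: "consistent_at c (f b q)"
  shows "c (f a p) < c (f 1 0) \<longleftrightarrow> c (f 1 0) < c (f b q)"
    "c (f a p) \<noteq> c (f 1 0)"
proof -
  obtain s X where s: "s \<in> {1, -1}" "\<forall>j\<le>p. c (f a j) = X - s * int j" "\<forall>j\<le>q. c (f b j) = X + s * int j"
    using cross_consecutive[OF c a b pq(2,4) cp cq] by blast
  have "c (f 1 0) = X" using s(2) body[OF a] by fastforce
  moreover have "c (f a p) = X - s * int p" "c (f b q) = X + s * int q" using s(2,3) by auto
  ultimately show "c (f a p) < c (f 1 0) \<longleftrightarrow> c (f 1 0) < c (f b q)" "c (f a p) \<noteq> c (f 1 0)"
    using s(1) pq by auto
qed

text \<open>Consistent vertices on different legs have labels on opposite sides of the body's label,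
  and there are only two sides.\<close>

lemma two_legs:
  assumes c: "interval_labeling c" and abe: "a \<in> {1..k}" "b \<in> {1..k}" "e \<in> {1..k}" "a \<noteq> b" "a \<noteq> e" "b \<noteq> e"
    and pqr: "1 \<le> p" "p \<le> l a" "1 \<le> q" "q \<le> l b" "1 \<le> r" "r \<le> l e"
    and con: "consistent_at c (f a p)" "consistent_at c (f b q)" "consistent_at c (f e r)"
  shows False
  using opposite_sides[OF c abe(1,2,4) pqr(1-4) con(1,2)]
    opposite_sides[OF c abe(1,3,5) pqr(1,2,5,6) con(1,3)]
    opposite_sides[OF c abe(2,3,6) pqr(3-6) con(2,3)] by linarith

lemma normalize_cross:
  assumes c: "interval_labeling c" and a: "a \<in> {1..k}" and b: "b \<in> {1..k}" "a \<noteq> b"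
    and pq: "p \<le> l a" "q \<le> l b"
    and cp: "consistent_at c (f a p)" and cq: "consistent_at c (f b q)"
  obtains c' X where "interval_labeling c'" "\<And>u. consistent_at c' u = consistent_at c u"
    "\<And>j. j \<le> p \<Longrightarrow> c' (f a j) = X - int j" "\<And>j. j \<le> q \<Longrightarrow> c' (f b j) = X + int j"
proof -
  obtain s X where s: "s \<in> {1, -1}" "\<forall>j\<le>p. c (f a j) = X - s * int j" "\<forall>j\<le>q. c (f b j) = X + s * int j"
    using cross_consecutive[OF c a b pq cp cq] by blast
  from s(1) consider "s = 1" | "s = -1" by blast
  then show ?thesis
  proof cases
    case 1 then show ?thesis using that[of c X] c s by simp
  next
    case 2 then show ?thesis using that[OF interval_labeling_uminus[OF c], of "-X"] s by simp
  qed
qed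

text \<open>A neighbour \<open>f i 1\<close> of the body on a third leg is nearer to
  \<open>f a p\<close> than \<open>f b 2\<close>, and nearer to \<open>f b q\<close> than
  \<open>f a 2\<close>. This confines its label to \<open>X - 2\<close> up to \<open>X + 2\<close>,
  and all five are taken by the two legs and the body.\<close>

lemma cross_inner:
  assumes c: "interval_labeling c" and a: "a \<in> {1..k}" and b: "b \<in> {1..k}" "a \<noteq> b"
    and pq: "2 \<le> p" "p \<le> l a" "2 \<le> q" "q \<le> l b"
    and cp: "consistent_at c (f a p)" and cq: "consistent_at c (f b q)"
  shows False
proof -
  obtain c' X where c': "interval_labeling c'" "\<And>u. consistent_at c' u = consistent_at c u"
    "\<And>j. j \<le> p \<Longrightarrow> c' (f a j) = X - int j" "\<And>j. j \<le> q \<Longrightarrow> c' (f b j) = X + int j"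
    using normalize_cross[OF c a b pq(2,4) cp cq] by blast
  obtain i where i: "i \<in> {1..k}" "i \<noteq> a" "i \<noteq> b" using third_leg[OF a b(1)] .
  have l: "1 \<le> l i" "2 \<le> l a" "2 \<le> l b" using l_pos[OF i(1)] pq by auto
  have V: "f i 1 \<in> V" "f a 2 \<in> V" "f b 2 \<in> V" using i(1) a b(1) l by auto
  have "d (f a p) (f i 1) < d (f a p) (f b 2)"
    using d_f[OF a i(1) pq(2) l(1)] d_f[OF a b(1) pq(2) l(3)] i b by simp
  then have "\<bar>c' (f a p) - c' (f i 1)\<bar> \<le> \<bar>c' (f a p) - c' (f b 2)\<bar>"
    using cp by (intro consistent_atD[OF _ V(1,3)]) (simp_all add: c'(2))
  moreover have "d (f b q) (f i 1) < d (f b q) (f a 2)"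
    using d_f[OF b(1) i(1) pq(4) l(1)] d_f[OF b(1) a pq(4) l(2)] i b by simp
  then have "\<bar>c' (f b q) - c' (f i 1)\<bar> \<le> \<bar>c' (f b q) - c' (f a 2)\<bar>"
    using cq by (intro consistent_atD[OF _ V(1,2)]) (simp_all add: c'(2))
  moreover have "c' (f a p) = X - int p" "c' (f b q) = X + int q" using c'(3,4) by auto
  moreover have v: "c' (f a 2) = X - 2" "c' (f a 1) = X - 1" "c' (f a 0) = X" "c' (f b 1) = X + 1" "c' (f b 2) = X + 2"
    using c'(3)[of 2] c'(3)[of 1] c'(3)[of 0] c'(4)[of 1] c'(4)[of 2] pq by auto
  ultimately have "c' (f i 1) \<in> {X - 2..X + 2}" by auto
  moreover have "c' (f i 1) \<noteq> c' (f a j)" if "j \<le> 2" for j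
    using label_neq[OF c'(1) V(1), of "f a j"] f_eq[OF i(1) a l(1), of j] that l i a by auto
  from this[of 0] this[of 1] this[of 2] have "c' (f i 1) \<notin> {X - 2, X - 1, X}" using v by auto
  moreover have "c' (f i 1) \<noteq> c' (f b j)" if "j \<le> 2" for j
    using label_neq[OF c'(1) V(1), of "f b j"] f_eq[OF i(1) b(1) l(1), of j] that l i b by auto
  from this[of 1] this[of 2] have "c' (f i 1) \<notin> {X + 1, X + 2}" using v by auto
  ultimately show False by auto
qed

text \<open>The body is left out so that different legs contribute disjoint sets.\<close>

definition rest :: "nat set \<Rightarrow> nat \<Rightarrow> 'a set" where
  "rest I h = (\<lambda>(e, j). f e j) ` (SIGMA e:I. {1..min (l e) h})"

lemma rest_cases:
  assumes "v \<in> rest I h" obtains e j where "e \<in> I" "1 \<le> j" "j \<le> h" "j \<le> l e" "v = f e j"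
  using assms unfolding rest_def by auto

lemma card_rest:
  assumes "I \<subseteq> {1..k}" shows "card (rest I h) = (\<Sum>e\<in>I. min (l e) h)"
proof -
  have "inj_on (\<lambda>(e, j). f e j) (SIGMA e:I. {1..min (l e) h})"
  proof (rule inj_onI)
    fix x y assume xy: "x \<in> (SIGMA e:I. {1..min (l e) h})" "y \<in> (SIGMA e:I. {1..min (l e) h})"
      "(\<lambda>(e, j). f e j) x = (\<lambda>(e, j). f e j) y"
    have "fst x \<in> {1..k}" "fst y \<in> {1..k}" "snd x \<le> l (fst x)" "snd y \<le> l (fst y)"
      using xy assms by auto
    from f_eq[OF this] show "x = y" using xy by (auto simp: case_prod_beta)
  qed
  moreover have "finite I" using assms finite_subset by blast
  ultimately show ?thesis unfolding rest_def by (simp add: card_image)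
qed

text \<open>Seen from \<open>f a 1\<close>, a vertex of a third leg at depth at most
  \<open>h\<close> is nearer than \<open>f b (h + 1)\<close>, whose label differs by
  \<open>h + 2\<close>. The labels above \<open>X - 1\<close> within that range belong to the body
  and leg \<open>b\<close>, so only the \<open>h + 2\<close> labels below \<open>X - 1\<close>
  remain.\<close>

lemma cross_leaf:
  assumes c: "interval_labeling c" and a: "a \<in> {1..k}" and b: "b \<in> {1..k}" "a \<noteq> b"
    and q: "2 \<le> q" "q \<le> l b"
    and cp: "consistent_at c (f a 1)" and cq: "consistent_at c (f b q)"
  shows "l a = 1"
    and "1 \<le> h \<Longrightarrow> h < q \<Longrightarrow> (\<Sum>e\<in>{1..k} - {a, b}. min (l e) h) \<le> h + 2"
proof -
  have la: "1 \<le> l a" by (rule l_pos[OF a])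
  obtain c' X where c': "interval_labeling c'" "\<And>u. consistent_at c' u = consistent_at c u"
    "\<And>j. j \<le> 1 \<Longrightarrow> c' (f a j) = X - int j" "\<And>j. j \<le> q \<Longrightarrow> c' (f b j) = X + int j"
    using normalize_cross[OF c a b la q(2) cp cq] by blast
  have ca: "c' (f a 1) = X - 1" using c'(3)[of 1] by simp
  have u: "consistent_at c' (f a 1)" "consistent_at c' (f b q)" using c'(2) cp cq by auto
  have left: "c' ` rest ({1..k} - {a, b}) h \<subseteq> {X - int h - 3..X - 2}" if h: "1 \<le> h" "h < q" for h
  proof
    fix y assume "y \<in> c' ` rest ({1..k} - {a, b}) h"
    then obtain x where x: "x \<in> rest ({1..k} - {a, b}) h" "y = c' x" by blast
    from x(1) obtain e j where "e \<in> {1..k} - {a, b}" "1 \<le> j" "j \<le> h" "j \<le> l e" "x = f e j"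
      by (rule rest_cases)
    then have e: "e \<in> {1..k}" "e \<noteq> a" "e \<noteq> b" "1 \<le> j" "j \<le> h" "j \<le> l e" "y = c' (f e j)"
      using x(2) by blast+
    have hb: "h + 1 \<le> l b" using h q by simp
    have V: "f e j \<in> V" "f b (h + 1) \<in> V" using e b hb by auto
    have "d (f a 1) (f e j) < d (f a 1) (f b (h + 1))"
      using d_f[OF a e(1) la e(6)] d_f[OF a b(1) la hb] e b by simp
    then have "\<bar>c' (f a 1) - y\<bar> \<le> \<bar>c' (f a 1) - c' (f b (h + 1))\<bar>"
      unfolding e(7) by (intro consistent_atD[OF u(1) V])
    moreover have "c' (f b (h + 1)) = X + int h + 1" using c'(4)[of "h + 1"] h by simp
    ultimately have "\<bar>X - 1 - y\<bar> \<le> int h + 2" using ca by simp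
    moreover have "y \<noteq> X - 1"
      using label_neq[OF c'(1) V(1), of "f a 1"] f_eq[OF e(1) a e(6) la] e a la ca by auto
    moreover have ne: "y \<noteq> X + int j'" if "j' \<le> h + 1" for j'
    proof -
      have j': "j' \<le> l b" "j' \<le> q" using that hb h by auto
      have "f e j \<noteq> f b j'" using f_eq[OF e(1) b(1) e(6) j'(1)] e by simp
      moreover have "f b j' \<in> V" using b(1) j' by auto
      ultimately show ?thesis using label_neq[OF c'(1) V(1), of "f b j'"] c'(4)[OF j'(2)] e(7) by simp
    qed
    have "\<not> (X \<le> y \<and> y \<le> X + int h + 1)"
    proof
      assume A: "X \<le> y \<and> y \<le> X + int h + 1"
      then have "nat (y - X) \<le> h + 1" by linarith
      from ne[OF this] show False using A by simp
    qed
    ultimately show "y \<in> {X - int h - 3..X - 2}" by auto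
  qed
  show "(\<Sum>e\<in>{1..k} - {a, b}. min (l e) h) \<le> h + 2" if h: "1 \<le> h" "h < q"
  proof -
    have "rest ({1..k} - {a, b}) h \<subseteq> V" by (auto elim!: rest_cases)
    then have "card (rest ({1..k} - {a, b}) h) = card (c' ` rest ({1..k} - {a, b}) h)"
      using c'(1) unfolding interval_labeling_def by (metis card_image inj_on_subset)
    also have "\<dots> \<le> card {X - int h - 3..X - 2}" by (intro card_mono left[OF h]) simp
    also have "\<dots> = h + 2" by simp
    finally show ?thesis using card_rest[of "{1..k} - {a, b}" h] by auto
  qed
  show "l a = 1"
  proof (rule ccontr)
    assume "l a \<noteq> 1"
    then have l2: "2 \<le> l a" using la by simp
    obtain i where i: "i \<in> {1..k}" "i \<noteq> a" "i \<noteq> b" using third_leg[OF a b(1)] .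
    have li: "1 \<le> l i" by (rule l_pos[OF i(1)])
    have V: "f i 1 \<in> V" "f a 2 \<in> V" using i(1) a li l2 by auto
    have "f i 1 \<in> rest ({1..k} - {a, b}) 1" unfolding rest_def using i li by force
    then have "c' (f i 1) \<in> {X - 4..X - 2}" using left[of 1] q by auto
    \<comment> \<open>A vertex \<open>f a 2\<close> would need a label nearer to
      \<open>X - 1\<close> than \<open>f i 1\<close> as seen from \<open>f a 1\<close>, yet farther
      from \<open>X + q\<close> as seen from \<open>f b q\<close>; with \<open>f i 1\<close> just
      below \<open>X - 1\<close> these two demands clash.\<close>
    moreover have "d (f a 1) (f a 2) < d (f a 1) (f i 1)"
      using d_f[OF a a la l2] d_f[OF a i(1) la li] i by simp
    then have "\<bar>c' (f a 1) - c' (f a 2)\<bar> \<le> \<bar>c' (f a 1) - c' (f i 1)\<bar>"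
      by (intro consistent_atD[OF u(1) V(2,1)])
    moreover have "d (f b q) (f i 1) < d (f b q) (f a 2)"
      using d_f[OF b(1) a q(2) l2] d_f[OF b(1) i(1) q(2) li] i b by simp
    then have "\<bar>c' (f b q) - c' (f i 1)\<bar> \<le> \<bar>c' (f b q) - c' (f a 2)\<bar>"
      by (intro consistent_atD[OF u(2) V(1,2)])
    moreover have "c' (f b q) = X + int q" using c'(4) by simp
    moreover have "c' (f a 2) \<noteq> c' (f i 1)"
      using label_neq[OF c'(1) V(2,1)] f_eq[OF a i(1) l2 li] by simp
    ultimately show False using ca q by auto
  qed
qed

text \<open>This handles the one situation where three consistent vertices, the body and two of its
  neighbours, exceed the generic value: \<open>k >= 4\<close> and longest leg 2. If
  \<open>f a 2\<close> existed, its label would be \<open>X - 2\<close> or \<open>X - 3\<close>, and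
  each is impossible.\<close>

lemma cross_short:
  assumes c: "interval_labeling c" and a: "a \<in> {1..k}" and b: "b \<in> {1..k}" "a \<noteq> b" and k: "4 \<le> k"
    and cp: "consistent_at c (f a 1)" and cq: "consistent_at c (f b 1)" and cw: "consistent_at c (f 1 0)"
  shows "l a = 1"
proof (rule ccontr)
  assume "l a \<noteq> 1"
  then have l2: "2 \<le> l a" and la: "1 \<le> l a" using l_pos[OF a] by auto
  have lb: "1 \<le> l b" by (rule l_pos[OF b(1)])
  obtain c' X where c': "interval_labeling c'" "\<And>u. consistent_at c' u = consistent_at c u"
    "\<And>j. j \<le> 1 \<Longrightarrow> c' (f a j) = X - int j" "\<And>j. j \<le> 1 \<Longrightarrow> c' (f b j) = X + int j"
    using normalize_cross[OF c a b la lb cp cq] by blast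
  have u: "consistent_at c' (f a 1)" "consistent_at c' (f a 0)" using c'(2) cp cw body[OF a] by auto
  have ca: "c' (f a 1) = X - 1" "c' (f a 0) = X" "c' (f b 1) = X + 1"
    using c'(3)[of 1] c'(3)[of 0] c'(4)[of 1] by auto
  have V: "f a 2 \<in> V" "f b 1 \<in> V" "f a 1 \<in> V" "f a 0 \<in> V" using a b la lb l2 by auto
  have "d (f a 1) (f a 2) < d (f a 1) (f b 1)"
    using d_f[OF a a la l2] d_f[OF a b(1) la lb] b by simp
  then have "\<bar>c' (f a 1) - c' (f a 2)\<bar> \<le> \<bar>c' (f a 1) - c' (f b 1)\<bar>"
    by (intro consistent_atD[OF u(1) V(1,2)])
  moreover have "c' (f a 2) \<noteq> c' (f a 0)" "c' (f a 2) \<noteq> c' (f a 1)" "c' (f a 2) \<noteq> c' (f b 1)"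
    using label_neq[OF c'(1) V(1)] V f_eq[OF a a l2, of 0] f_eq[OF a a l2 la] f_eq[OF a b(1) l2 lb] by auto
  ultimately have a2: "c' (f a 2) = X - 2 \<or> c' (f a 2) = X - 3" using ca by auto
  have nb: "c' (f i 1) \<in> {X - 3..X + 3} - {X - 1, X, X + 1, c' (f a 2)} \<and>
      \<bar>c' (f i 1) - X\<bar> \<le> \<bar>c' (f a 2) - X\<bar>"
    if i: "i \<in> {1..k}" "i \<noteq> a" "i \<noteq> b" for i
  proof -
    have li: "1 \<le> l i" by (rule l_pos[OF i(1)])
    have Vi: "f i 1 \<in> V" using i li by auto
    have "d (f a 0) (f i 1) < d (f a 0) (f a 2)"
      using d_f[OF a a _ l2, of 0] d_f[OF a i(1) _ li, of 0] i by simp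
    then have "\<bar>c' (f a 0) - c' (f i 1)\<bar> \<le> \<bar>c' (f a 0) - c' (f a 2)\<bar>"
      by (intro consistent_atD[OF u(2) Vi V(1)])
    then have "\<bar>c' (f i 1) - X\<bar> \<le> \<bar>c' (f a 2) - X\<bar>" using ca by linarith
    moreover have "c' (f i 1) \<noteq> c' (f a 2)" "c' (f i 1) \<noteq> c' (f a 1)"
      "c' (f i 1) \<noteq> c' (f a 0)" "c' (f i 1) \<noteq> c' (f b 1)"
      using label_neq[OF c'(1) Vi] V f_eq[OF i(1) a li l2] f_eq[OF i(1) a li la]
        f_eq[OF i(1) a li, of 0] f_eq[OF i(1) b(1) li lb] i by auto
    ultimately show ?thesis using a2 ca by auto
  qed
  show False
  proof (cases "c' (f a 2) = X - 2")
    case True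
    \<comment> \<open>Consistency of the body forces every remaining neighbour of the body to the
      single label \<open>X + 2\<close>, while \<open>k >= 4\<close> leaves at least two such
      neighbours.\<close>
    have "card ({1..k} - {a, b}) = k - 2" using a b by simp
    then have "1 < card ({1..k} - {a, b})" using k by simp
    then obtain i j where ij: "i \<in> {1..k} - {a, b}" "j \<in> {1..k} - {a, b}" "i \<noteq> j"
      by (metis One_nat_def card_le_Suc0_iff_eq finite_Diff finite_atLeastAtMost not_less)
    have "c' (f e 1) = X + 2" if "e \<in> {1..k} - {a, b}" for e
    proof -
      have "\<bar>c' (f e 1) - X\<bar> \<le> 2" "c' (f e 1) \<notin> {X - 2, X - 1, X, X + 1}"
        using nb[of e] that True by auto
      then show ?thesis by auto
    qed
    then have "c' (f i 1) = X + 2" "c' (f j 1) = X + 2" using ij by auto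
    moreover have "f i 1 \<noteq> f j 1" using f_eq[of i j 1 1] ij l_pos by auto
    moreover have "f i 1 \<in> V" "f j 1 \<in> V" using ij l_pos by auto
    ultimately show False using label_neq[OF c'(1)] by metis
  next
    case False
    then have m3: "c' (f a 2) = X - 3" using a2 by simp
    \<comment> \<open>The label \<open>X - 2\<close> is skipped by \<open>f a 2\<close>; its owner
      \<open>z\<close> is labeled next to \<open>f a 1\<close>, hence must be within distance 1 of
      it, but all such vertices have other labels.\<close>
    obtain z where z: "z \<in> V" "c' z = X - 2"
      using label_attained[OF c'(1) V(1,3), of "X - 2"] m3 ca by auto
    have "\<not> d (f a 1) (f a 2) < d (f a 1) z"
    proof
      assume "d (f a 1) (f a 2) < d (f a 1) z"
      then have "\<bar>c' (f a 1) - c' (f a 2)\<bar> \<le> \<bar>c' (f a 1) - c' z\<bar>"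
        by (intro consistent_atD[OF u(1) V(1) z(1)])
      then show False using z m3 ca by simp
    qed
    then have dz: "d (f a 1) z \<le> 1" using d_f[OF a a la l2] by simp
    obtain i j where ij: "i \<in> {1..k}" "j \<le> l i" "z = f i j" using V_cases[OF z(1)] .
    have "z = f a 0 \<or> z = f a 1 \<or> z = f a 2"
    proof (cases "i = a")
      case True
      then have "(1 - j) + (j - 1) \<le> 1" using dz d_f[OF a a la, of j] ij by simp
      then have "j = 0 \<or> j = 1 \<or> j = 2" by arith
      then show ?thesis using True ij(3) by blast
    next
      case False
      then have "j = 0" using dz d_f[OF a ij(1) la ij(2)] ij by simp
      then show ?thesis using ij body[OF a] body[OF ij(1)] by simp
    qed
    then show False using z ca m3 by auto
  qed
qed

section \<open>Upper bound from the shape of the consistent set\<close>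

definition consistent_set :: "('a \<Rightarrow> int) \<Rightarrow> 'a set" where
  "consistent_set c = {u \<in> V. consistent_at c u}"

text \<open>\<open>two_legs\<close> leaves at most two legs, and \<open>cross_inner\<close> allows
  only one of them to have consistent vertices at depth 2 or more. Case \<open>long\<close> records
  such a depth \<open>q\<close> because \<open>cross_leaf\<close> needs it.\<close>

lemma consistent_set_cases:
  assumes c: "interval_labeling c"
  obtains (leg) b where "b \<in> {1..k}" "consistent_set c \<subseteq> f b ` {0..l b}"
  | (short) a b where "a \<in> {1..k}" "b \<in> {1..k}" "a \<noteq> b" "consistent_set c \<subseteq> {f a 1, f 1 0, f b 1}"
  | (long) a b q where "a \<in> {1..k}" "b \<in> {1..k}" "a \<noteq> b" "2 \<le> q" "q \<le> l b"
      "consistent_at c (f b q)" "consistent_at c (f a 1)" "consistent_set c \<subseteq> insert (f a 1) (f b ` {0..l b})"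
proof (cases "\<exists>b\<in>{1..k}. consistent_set c \<subseteq> f b ` {0..l b}")
  case True then show ?thesis using leg by blast
next
  case False
  have in1: "1 \<in> {1..k}" using k_ge by simp
  have w: "f 1 0 \<in> f e ` {0..l e}" if "e \<in> {1..k}" for e using body[OF that] by force
  \<comment> \<open>Each leg here includes the body, so a consistent vertex off leg \<open>1\<close>
    is not the body. Leaving its own leg \<open>b\<close> then yields a second one on a different
    leg.\<close>
  obtain u where u: "u \<in> consistent_set c" "u \<notin> f 1 ` {0..l 1}" using False in1 by blast
  then obtain b q where bq: "b \<in> {1..k}" "q \<le> l b" "u = f b q" "consistent_at c u"
    unfolding consistent_set_def by (auto elim!: V_cases)
  have q1: "1 \<le> q" using bq u(2) body[OF bq(1)] by (cases q) force+
  obtain u' where u': "u' \<in> consistent_set c" "u' \<notin> f b ` {0..l b}" using False bq(1) by blast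
  then obtain a p where ap: "a \<in> {1..k}" "p \<le> l a" "u' = f a p" "consistent_at c u'"
    unfolding consistent_set_def by (auto elim!: V_cases)
  have p1: "1 \<le> p" using ap u'(2) w[OF bq(1)] body[OF ap(1)] by (cases p) auto
  have ab: "a \<noteq> b" using ap u' by auto
  have cons': "consistent_at c (f a p)" "consistent_at c (f b q)" using ap bq by auto
  have two: "x \<in> f a ` {0..l a} \<union> f b ` {0..l b}" if "x \<in> consistent_set c" for x
  proof -
    obtain e r where er: "e \<in> {1..k}" "r \<le> l e" "x = f e r" "consistent_at c x"
      using \<open>x \<in> consistent_set c\<close> unfolding consistent_set_def by (auto elim!: V_cases)
    show ?thesis
    proof (cases "r = 0 \<or> e = a \<or> e = b")
      case True then show ?thesis using er w[OF bq(1)] body[OF er(1)] by auto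
    next
      case False
      then have "a \<noteq> e" "b \<noteq> e" "1 \<le> r" by auto
      from two_legs[OF c ap(1) bq(1) er(1) ab this(1,2) p1 ap(2) q1 bq(2) this(3) er(2) cons']
      show ?thesis using er by auto
    qed
  qed
  \<comment> \<open>Stated for arbitrary \<open>a'\<close> and \<open>b'\<close>, since either of
    the two legs may be the one with a deep consistent vertex.\<close>
  have swap: thesis if B: "b' \<in> {1..k}" "a' \<in> {1..k}" "a' \<noteq> b'" "2 \<le> r" "r \<le> l b'" "consistent_at c (f b' r)"
    "1 \<le> p'" "p' \<le> l a'" "consistent_at c (f a' p')"
    "\<And>x. x \<in> consistent_set c \<Longrightarrow> x \<in> f a' ` {0..l a'} \<union> f b' ` {0..l b'}" for a' b' r p'
  proof -
    have le1: "j \<le> 1" if "j \<le> l a'" "consistent_at c (f a' j)" for j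
    proof (rule ccontr)
      assume "\<not> j \<le> 1"
      then have "2 \<le> j" by simp
      from cross_inner[OF c B(2,1,3) this that(1) B(4,5) that(2) B(6)] show False .
    qed
    then have "p' = 1" using B by (simp add: le_antisym)
    moreover have "consistent_set c \<subseteq> insert (f a' 1) (f b' ` {0..l b'})"
    proof
      fix x assume x: "x \<in> consistent_set c"
      show "x \<in> insert (f a' 1) (f b' ` {0..l b'})"
      proof (cases "x \<in> f b' ` {0..l b'}")
        case False
        then obtain j where j: "j \<le> l a'" "x = f a' j" using B(10)[OF x] by auto
        then have "j \<le> 1" using le1 x unfolding consistent_set_def by auto
        moreover have "j \<noteq> 0" using False w[OF B(1)] body[OF B(2)] j by auto
        ultimately have "j = 1" by simp
        then show ?thesis using j by simp
      qed simp
    qed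
    ultimately show thesis using long[OF B(2,1,3,4,5,6)] B by simp
  qed
  show ?thesis
  proof (cases "\<exists>r. 2 \<le> r \<and> r \<le> l b \<and> consistent_at c (f b r)")
    case True
    then show ?thesis using swap[OF bq(1) ap(1) ab _ _ _ p1 ap(2) cons'(1) two] by blast
  next
    case nb: False
    show ?thesis
    proof (cases "\<exists>r. 2 \<le> r \<and> r \<le> l a \<and> consistent_at c (f a r)")
      case True
      have two': "x \<in> f b ` {0..l b} \<union> f a ` {0..l a}" if "x \<in> consistent_set c" for x using two[OF that] by blast
      show ?thesis using True swap[OF ap(1) bq(1) ab[symmetric] _ _ _ q1 bq(2) cons'(2) two'] by blast
    next
      case na: False
      have "consistent_set c \<subseteq> {f a 1, f 1 0, f b 1}"
      proof
        fix x assume x: "x \<in> consistent_set c"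
        then obtain e j where e: "e = a \<or> e = b" "j \<le> l e" "x = f e j" using two by force
        have "consistent_at c (f e j)" using x e unfolding consistent_set_def by simp
        then have "j < 2" using na nb e by (meson not_less)
        then have "j = 0 \<or> j = 1" by arith
        then show "x \<in> {f a 1, f 1 0, f b 1}"
          using e body[OF ap(1)] body[OF bq(1)] by auto
      qed
      then show ?thesis using short[OF ap(1) bq(1) ab] by blast
    qed
  qed
qed

text \<open>All consistent depths lie between the smallest one, \<open>p\<close>, and
  \<open>l b\<close>, and \<open>u\<close> bounds \<open>p\<close> from below. The offset
  \<open>e\<close> is 2 for \<open>k >= 4\<close> and 3 for three legs of length at least 2. Missing
  the leaf lowers the count by one, hence its double by two.\<close>

lemma leg_count:
  assumes b: "b \<in> {1..k}" and e: "2 \<le> e"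
    and u: "\<And>p q. p < q \<Longrightarrow> q \<le> l b \<Longrightarrow> consistent_at c (f b p) \<Longrightarrow> consistent_at c (f b q) \<Longrightarrow> l b < 2 * p + e"
  shows "2 * card (consistent_set c \<inter> f b ` {0..l b}) \<le> l b + e + 1"
    and "\<not> consistent_at c (f b (l b)) \<Longrightarrow> 2 * card (consistent_set c \<inter> f b ` {0..l b}) \<le> l b + e - 1"
proof -
  have lb: "1 \<le> l b" by (rule l_pos[OF b])
  define J where "J = {j. j \<le> l b \<and> consistent_at c (f b j)}"
  have "finite J" unfolding J_def by simp
  have "consistent_set c \<inter> f b ` {0..l b} \<subseteq> f b ` J" unfolding consistent_set_def J_def by auto
  then have "card (consistent_set c \<inter> f b ` {0..l b}) \<le> card (f b ` J)" by (intro card_mono) (simp_all add: \<open>finite J\<close>)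
  also have "\<dots> \<le> card J" by (rule card_image_le[OF \<open>finite J\<close>])
  finally have le: "card (consistent_set c \<inter> f b ` {0..l b}) \<le> card J" .
  have "2 * card J \<le> l b + e + 1 \<and> (l b \<notin> J \<longrightarrow> 2 * card J \<le> l b + e - 1)"
  proof (cases "card J \<le> 1")
    case True then show ?thesis using e lb by auto
  next
    case False
    then have "J \<noteq> {}" by auto
    define p where "p = Min J"
    have p: "p \<in> J" "\<And>j. j \<in> J \<Longrightarrow> p \<le> j" unfolding p_def using \<open>finite J\<close> \<open>J \<noteq> {}\<close> by auto
    have "\<exists>q\<in>J. q \<noteq> p"
    proof (rule ccontr)
      assume "\<not> (\<exists>q\<in>J. q \<noteq> p)"
      then have "J \<subseteq> {p}" by blast
      then have "card J \<le> card {p}" by (intro card_mono) auto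
      then show False using False by simp
    qed
    then obtain q where q: "q \<in> J" "p < q" using p(2) by (metis le_neq_implies_less)
    have lt: "l b < 2 * p + e" using u[OF q(2)] p(1) q(1) unfolding J_def by blast
    have "J \<subseteq> {p..l b}" using p(2) unfolding J_def by auto
    then have 1: "card J \<le> l b + 1 - p" using card_mono[of "{p..l b}" J] by simp
    have 2: "card J \<le> l b - p" if "l b \<notin> J"
    proof -
      have "J \<subseteq> {p..<l b}" using \<open>J \<subseteq> {p..l b}\<close> that by (auto simp: le_less)
      then show ?thesis using card_mono[of "{p..<l b}" J] by simp
    qed
    have "p < l b" using q unfolding J_def by auto
    then show ?thesis using 1 2 lt e by (cases "l b \<in> J") auto
  qed
  then show "2 * card (consistent_set c \<inter> f b ` {0..l b}) \<le> l b + e + 1"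
    "\<not> consistent_at c (f b (l b)) \<Longrightarrow> 2 * card (consistent_set c \<inter> f b ` {0..l b}) \<le> l b + e - 1"
    using le unfolding J_def by auto
qed

lemma l_last: "i \<in> {1..k} \<Longrightarrow> l i \<le> l k"
  using l_mono[of i k] k_ge by simp

lemma l_first: "i \<in> {1..k} \<Longrightarrow> l 1 \<le> l i"
  using l_mono[of 1 i] k_ge by simp

lemma l_second:
  assumes "i \<in> {1..k}" "j \<in> {1..k}" "i \<noteq> j" "l i \<le> m" "l j \<le> m" shows "l 2 \<le> m"
proof -
  have "2 \<le> i \<or> 2 \<le> j" using assms by auto
  then show ?thesis using l_mono[of 2 i] l_mono[of 2 j] assms k_ge by fastforce
qed

lemma l_third:
  assumes "i \<in> {1..k}" "j \<in> {1..k}" "e \<in> {1..k}" "i \<noteq> j" "i \<noteq> e" "j \<noteq> e" "l i \<le> m" "l j \<le> m" "l e \<le> m"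
  shows "l 3 \<le> m"
proof -
  have "3 \<le> i \<or> 3 \<le> j \<or> 3 \<le> e" using assms by auto
  then show ?thesis using l_mono[of 3 i] l_mono[of 3 j] l_mono[of 3 e] assms k_ge by fastforce
qed

text \<open>Halves rounded down and up are written as \<open>n div 2\<close> and
  \<open>(n + 1) div 2\<close> to stay within the natural numbers.\<close>

definition ldc_value :: nat where
  "ldc_value = (if l k = 1 then 3
     else if k = 3 \<and> l 1 = 1 then l 3 + 2
     else if k = 3 then l 3 div 2 + 2
     else if l 1 = 1 \<and> condition_E k l then (l k + 1) div 2 + 2
     else (l k + 1) div 2 + 1)"

text \<open>\<open>h = 1\<close> gives \<open>k <= 5\<close>. For \<open>k = 4\<close>,
  \<open>h = 3\<close> forbids both remaining legs to be longer than 2, which would need 6 places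
  out of 5. For \<open>k = 5\<close>, \<open>h = 2\<close> offers 4 places to three legs, so two of
  them have length 1. If leg \<open>b\<close> is too short for that \<open>h\<close>,
  \<open>half\<close> bounds the longest leg instead. The case \<open>k >= 6\<close> of (E) arises
  only through \<open>cross_short\<close>.\<close>

lemma tight_E:
  assumes k: "4 \<le> k" and a: "a \<in> {1..k}" "l a = 1" and b: "b \<in> {1..k}" "a \<noteq> b" "2 \<le> l b"
    and half: "(l b + 1) div 2 = (l k + 1) div 2"
    and sums: "\<And>h. 1 \<le> h \<Longrightarrow> h < l b \<Longrightarrow> (\<Sum>e\<in>{1..k} - {a, b}. min (l e) h) \<le> h + 2"
  shows "condition_E k l"
proof -
  have cd: "card ({1..k} - {a, b}) = k - 2" using a b by simp
  have "(\<Sum>e\<in>{1..k} - {a, b}. min (l e) 1) = (\<Sum>e\<in>{1..k} - {a, b}. 1)"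
  proof (rule sum.cong[OF refl])
    fix e assume "e \<in> {1..k} - {a, b}"
    then have "1 \<le> l e" using l_pos by blast
    then show "min (l e) 1 = 1" by simp
  qed
  then have "k - 2 \<le> 3" using sums[of 1] b cd by simp
  then consider "k = 4" | "k = 5" using k by linarith
  then show ?thesis
  proof cases
    case 1
    then obtain i j where ij: "{1..k} - {a, b} = {i, j}" "i \<noteq> j" using cd by (auto simp: card_2_iff)
    have "i \<in> {1..k} - {a, b}" "j \<in> {1..k} - {a, b}" unfolding ij by auto
    then have i: "i \<in> {1..k}" "j \<in> {1..k}" "a \<noteq> i" "a \<noteq> j" by auto
    show ?thesis
    proof (cases "4 \<le> l b")
      case True
      then have "min (l i) 3 + min (l j) 3 \<le> 5" using sums[of 3] ij by simp
      then have "l i \<le> 2 \<or> l j \<le> 2" by auto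
      then have "l 2 \<le> 2" using l_second[OF a(1) i(1) i(3)] l_second[OF a(1) i(2) i(4)] a(2) by auto
      then show ?thesis unfolding condition_E_def using 1 by simp
    next
      case False
      then have "l 2 \<le> 3" using l_second[OF a(1) b(1,2)] a(2) by auto
      moreover have "l k \<le> 4" using half False by linarith
      ultimately show ?thesis unfolding condition_E_def using 1 by auto
    qed
  next
    case 2
    then obtain i j e where ij: "{1..k} - {a, b} = {i, j, e}" "i \<noteq> j" "i \<noteq> e" "j \<noteq> e"
      using cd by (auto simp: card_3_iff)
    have "i \<in> {1..k} - {a, b}" "j \<in> {1..k} - {a, b}" "e \<in> {1..k} - {a, b}" unfolding ij by auto
    then have i: "i \<in> {1..k}" "j \<in> {1..k}" "e \<in> {1..k}" "a \<noteq> i" "a \<noteq> j" "a \<noteq> e" by auto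
    show ?thesis
    proof (cases "3 \<le> l b")
      case True
      then have "min (l i) 2 + min (l j) 2 + min (l e) 2 \<le> 4" using sums[of 2] ij by simp
      then have "(l i \<le> 1 \<and> l j \<le> 1) \<or> (l i \<le> 1 \<and> l e \<le> 1) \<or> (l j \<le> 1 \<and> l e \<le> 1)"
        using l_pos[OF i(1)] l_pos[OF i(2)] l_pos[OF i(3)] by (auto simp: min_def split: if_splits)
      then have "l 3 \<le> 1"
        using l_third[OF a(1) i(1,2) i(4,5) ij(2)] l_third[OF a(1) i(1,3) i(4,6) ij(3)]
          l_third[OF a(1) i(2,3) i(5,6) ij(4)] a(2) by auto
      then show ?thesis unfolding condition_E_def using 2 l_pos[of 3] by auto
    next
      case False
      then have "l b = 2" using b(3) by simp
      then have "(l k + 1) div 2 = 1" using half by simp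
      then have "l k \<le> 2" by linarith
      then show ?thesis unfolding condition_E_def using 2 b l_last[OF b(1)] by auto
    qed
  qed
qed

lemma upper_bound:
  assumes c: "interval_labeling c" shows "card (consistent_set c) \<le> ldc_value"
proof -
  have fin: "finite (consistent_set c)" unfolding consistent_set_def by simp
  have k1: "1 \<in> {1..k}" "k \<in> {1..k}" using k_ge by auto
  note lp = l_pos[OF k1(1)] l_pos[OF k1(2)]
  have cnt: "card (consistent_set c \<inter> f b ` {0..l b}) \<le> l b + 1" for b
  proof -
    have "card (consistent_set c \<inter> f b ` {0..l b}) \<le> card (f b ` {0..l b})" by (intro card_mono) auto
    also have "\<dots> \<le> l b + 1" using card_image_le[of "{0..l b}" "f b"] by simp
    finally show ?thesis .
  qed
  have cnt4: "card (consistent_set c \<inter> f b ` {0..l b}) \<le> (l b + 1) div 2 + 1" if "4 \<le> k" "b \<in> {1..k}" for b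
    using leg_count(1)[OF that(2), of 2 c] inner_unique[OF c that(2) _ _ _ _ that(1)] by simp
  have cnt3: "card (consistent_set c \<inter> f b ` {0..l b}) \<le> l b div 2 + 2" if "k = 3" "2 \<le> l 1" "b \<in> {1..k}" for b
  proof -
    have "2 \<le> l i" if "i \<in> {1..k}" for i using l_first[OF that] \<open>2 \<le> l 1\<close> by simp
    then show ?thesis
      using leg_count(1)[OF that(3), of 3 c] inner_unique3[OF c that(3) _ _ _ _ that(1)] by simp
  qed
  from c show ?thesis
  proof (cases rule: consistent_set_cases)
    case (leg b)
    then have e: "consistent_set c = consistent_set c \<inter> f b ` {0..l b}" by blast
    have lb: "l b \<le> l k" by (rule l_last[OF leg(1)])
    show ?thesis
    proof (cases "4 \<le> k")
      case True
      have "card (consistent_set c) \<le> (l b + 1) div 2 + 1" using cnt4[OF True leg(1)] e by simp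
      moreover have "(l b + 1) div 2 \<le> (l k + 1) div 2" using lb by (simp add: div_le_mono)
      ultimately show ?thesis unfolding ldc_value_def using True by auto
    next
      case False
      then have k: "k = 3" using k_ge by simp
      have "card (consistent_set c) \<le> l b + 1" using cnt e by metis
      moreover have "card (consistent_set c) \<le> l b div 2 + 2" if "l 1 \<noteq> 1" using cnt3[OF k _ leg(1)] e lp that by simp
      moreover have "l b div 2 \<le> l k div 2" using lb by (simp add: div_le_mono)
      ultimately show ?thesis unfolding ldc_value_def using lb k by (auto split: if_splits)
    qed
  next
    case (short a b)
    have "card (consistent_set c) \<le> card {f a 1, f 1 0, f b 1}" by (intro card_mono short) simp
    also have "\<dots> \<le> 3" by (simp add: card_insert_if)
    finally have le3: "card (consistent_set c) \<le> 3" .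
    \<comment> \<open>The claimed value is below 3 only if \<open>k >= 4\<close>, the longest leg
      has length 2 and (E) or \<open>l 1 = 1\<close> fails; this leaves a single case to
      examine.\<close>
    show ?thesis
    proof (cases "4 \<le> k \<and> l k = 2 \<and> card (consistent_set c) = 3")
      case True
      have "consistent_set c = {f a 1, f 1 0, f b 1}"
        by (rule card_seteq) (use short True in \<open>auto simp: card_insert_if\<close>)
      then have con: "consistent_at c (f a 1)" "consistent_at c (f b 1)" "consistent_at c (f 1 0)" unfolding consistent_set_def by auto
      have "l a = 1" by (rule cross_short[OF c short(1-3)]) (use True con in auto)
      moreover have "l b = 1"
        by (rule cross_short[OF c short(2,1) short(3)[symmetric]]) (use True con in auto)
      ultimately have "l 1 \<le> 1" "l 2 \<le> 1"
        using l_first[OF short(1)] l_second[OF short(1-3)] by auto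
      moreover have "1 \<le> l 2" using l_pos[of 2] k_ge by simp
      moreover have "k = 4 \<or> k = 5 \<or> 6 \<le> k" using True by auto
      ultimately have "l 1 = 1" "condition_E k l" using True lp unfolding condition_E_def by auto
      then show ?thesis unfolding ldc_value_def using le3 True by auto
    next
      case False
      then show ?thesis unfolding ldc_value_def using le3 lp k_ge by auto
    qed
  next
    case (long a b q)
    have lb: "l b \<le> l k" by (rule l_last[OF long(2)])
    note cl = cross_leaf[OF c long(1,2,3,4,5,7,6)]
    have l1: "l 1 = 1" using cl(1) l_first[OF long(1)] lp by simp
    have lk: "l k \<noteq> 1" using lb long by simp
    have "consistent_set c \<subseteq> insert (f a 1) (consistent_set c \<inter> f b ` {0..l b})" using long(8) by blast
    then have "card (consistent_set c) \<le> card (insert (f a 1) (consistent_set c \<inter> f b ` {0..l b}))" by (intro card_mono) (simp_all add: fin)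
    also have "\<dots> \<le> Suc (card (consistent_set c \<inter> f b ` {0..l b}))" by (rule card_insert_le_m1) simp_all
    finally have cS: "card (consistent_set c) \<le> card (consistent_set c \<inter> f b ` {0..l b}) + 1" by simp
    show ?thesis
    proof (cases "4 \<le> k")
      case False
      then have "k = 3" using k_ge by simp
      then show ?thesis unfolding ldc_value_def using l1 lk cS cnt[of b] lb by auto
    next
      case True
      have half: "(l b + 1) div 2 \<le> (l k + 1) div 2" using lb by (simp add: div_le_mono)
      show ?thesis
      proof (cases "card (consistent_set c) \<le> (l k + 1) div 2 + 1")
        case True then show ?thesis unfolding ldc_value_def using l1 lk \<open>4 \<le> k\<close> by auto
      next
        case big: False
        \<comment> \<open>The leg \<open>b\<close> bound plus one for \<open>f a 1\<close> exceeds
          the generic value by at most one, so exceeding it makes every estimate tight.\<close>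
        then have eq: "(l b + 1) div 2 = (l k + 1) div 2" using cS cnt4[OF True long(2)] half by linarith
        \<comment> \<open>With the leaf of leg \<open>b\<close> missing, the count would fall back
          to the generic value. Its consistency allows \<open>q = l b\<close> in
          \<open>cross_leaf\<close>, so all \<open>h < l b\<close> become available.\<close>
        have last: "consistent_at c (f b (l b))"
        proof (rule ccontr)
          assume "\<not> consistent_at c (f b (l b))"
          then have "2 * card (consistent_set c \<inter> f b ` {0..l b}) \<le> l b + 2 - 1"
            using leg_count(2)[OF long(2), of 2 c] inner_unique[OF c long(2) _ _ _ _ True] by simp
          then show False using big cS eq by simp
        qed
        have lb2: "2 \<le> l b" using long by simp
        have "condition_E k l"
          using tight_E[OF True long(1) cl(1) long(2,3) lb2 eq]
            cross_leaf(2)[OF c long(1,2,3) lb2 order_refl long(7) last] by blast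
        then show ?thesis unfolding ldc_value_def using l1 lk True cS cnt4[OF True long(2)] eq by auto
      qed
    qed
  qed
qed

subsection \<open>Lower bound\<close>

lemma V_cases_leg:
  assumes "v \<in> V" "b \<in> {1..k}"
  obtains j where "j \<le> l b" "v = f b j"
  | i j where "i \<in> {1..k}" "i \<noteq> b" "1 \<le> j" "j \<le> l i" "v = f i j"
proof -
  obtain i j where ij: "i \<in> {1..k}" "j \<le> l i" "v = f i j" using V_cases[OF assms(1)] .
  consider "i = b" | "j = 0" | "i \<noteq> b" "1 \<le> j" by linarith
  then show ?thesis
  proof cases
    case 1 then show ?thesis using that(1) ij by blast
  next
    case 2 then show ?thesis using that(1)[of 0] body[OF ij(1)] body[OF assms(2)] ij by simp
  next
    case 3 then show ?thesis using that(2) ij by blast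
  qed
qed

lemma inj_leg:
  assumes "b \<in> {1..k}" shows "inj_on (f b) {..l b}"
proof (rule inj_onI)
  fix i j assume "i \<in> {..l b}" "j \<in> {..l b}" "f b i = f b j"
  then show "i = j" using f_eq[OF assms assms, of i j] by simp
qed

text \<open>Since \<open>b\<close> is not \<open>1\<close>, the body's neighbour on a shortest leg
  is free to take the first label after the body; it is the additional consistent leaf when
  \<open>l 1 = 1\<close>. The last clause holds because only vertices of leg \<open>b\<close> or of
  depth at most \<open>j\<close> can precede or equal \<open>f i j\<close>.\<close>

lemma outward_labeling:
  assumes b: "b \<in> {1..k}" "b \<noteq> 1"
  obtains c where "bij_betw c V {1..card V}"
    "\<And>j. j \<le> l b \<Longrightarrow> c (f b j) = l b + 1 - j"
    "c (f 1 1) = l b + 2"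
    "\<And>i j i' j'. i \<in> {1..k} \<Longrightarrow> i' \<in> {1..k} \<Longrightarrow> i \<noteq> b \<Longrightarrow> i' \<noteq> b \<Longrightarrow> 1 \<le> j \<Longrightarrow> j < j' \<Longrightarrow>
      j \<le> l i \<Longrightarrow> j' \<le> l i' \<Longrightarrow> c (f i j) < c (f i' j')"
    "\<And>i j. i \<in> {1..k} \<Longrightarrow> i \<noteq> b \<Longrightarrow> 1 \<le> j \<Longrightarrow> j \<le> l i \<Longrightarrow> l b + 1 < c (f i j)"
    "\<And>i j. i \<in> {1..k} \<Longrightarrow> i \<noteq> b \<Longrightarrow> 1 \<le> j \<Longrightarrow> j \<le> l i \<Longrightarrow>
      c (f i j) \<le> l b + 1 + (\<Sum>e\<in>{1..k} - {b}. min (l e) j)"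
proof -
  \<comment> \<open>The body occurs once, as depth 0 of leg \<open>b\<close>, which makes the
    coordinate map injective on \<open>I\<close>.\<close>
  define I where "I = (SIGMA i:{1..k}. if i = b then {0..l b} else {1..l i})"
  define F where "F = (\<lambda>(i, j). f i j)"
  \<comment> \<open>The weight \<open>k + 1\<close> exceeds every leg index, so off leg
    \<open>b\<close> keys compare by depth and then by leg index. Gaps between keys are closed by
    \<open>rank_labeling\<close>.\<close>
  define K where "K = (\<lambda>(i, j). if i = b then l b - j else l b + j * (k + 1) + i)"
  define key where "key v = K (inv_into I F v)" for v
  have injF: "inj_on F I"
  proof (rule inj_onI)
    fix x y assume xy: "x \<in> I" "y \<in> I" "F x = F y"
    obtain i j i' j' where e: "x = (i, j)" "y = (i', j')" by fastforce
    have "i \<in> {1..k}" "i' \<in> {1..k}" "j \<le> l i" "j' \<le> l i'"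
      using xy unfolding I_def e by (auto split: if_splits)
    from f_eq[OF this] show "x = y" using xy unfolding I_def e F_def by (auto split: if_splits)
  qed
  have keyb: "key (f b j) = l b - j" if "j \<le> l b" for j
  proof -
    have "inv_into I F (F (b, j)) = (b, j)"
      by (rule inv_into_f_f[OF injF]) (use b that in \<open>auto simp: I_def\<close>)
    then show ?thesis unfolding key_def F_def K_def by simp
  qed
  have keyi: "key (f i j) = l b + j * (k + 1) + i" if "i \<in> {1..k}" "i \<noteq> b" "1 \<le> j" "j \<le> l i" for i j
  proof -
    have "inv_into I F (F (i, j)) = (i, j)"
      by (rule inv_into_f_f[OF injF]) (use that in \<open>auto simp: I_def\<close>)
    then show ?thesis unfolding key_def F_def K_def using that by simp
  qed
  have lt: "j * (k + 1) + i < j' * (k + 1) + i'" if "i \<le> k" "1 \<le> i'" "j < j'" for i j i' j'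
  proof -
    have "j * (k + 1) + (k + 1) \<le> j' * (k + 1)"
      using mult_le_mono1[of "Suc j" j' "k + 1"] that by simp
    then show ?thesis using that by simp
  qed
  have inj: "inj_on key V"
  proof (rule inj_onI)
    fix u v assume uv: "u \<in> V" "v \<in> V" "key u = key v"
    from uv(1) b(1) show "u = v"
    proof (cases rule: V_cases_leg)
      case u: (1 j)
      from uv(2) b(1) show ?thesis
      proof (cases rule: V_cases_leg)
        case v: (1 j')
        then have "l b - j = l b - j'" using u uv(3) keyb[OF u(1)] keyb[OF v(1)] by simp
        then have "j = j'" using u(1) v(1) by arith
        then show ?thesis using u v by simp
      next
        case v: (2 i' j')
        then show ?thesis using u uv(3) keyb[OF u(1)] keyi[OF v(1-4)] by simp
      qed
    next
      case u: (2 i j)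
      from uv(2) b(1) show ?thesis
      proof (cases rule: V_cases_leg)
        case v: (1 j')
        then show ?thesis using u uv(3) keyb[OF v(1)] keyi[OF u(1-4)] by simp
      next
        case v: (2 i' j')
        have e: "j * (k + 1) + i = j' * (k + 1) + i'"
          using uv(3) u(5) v(5) keyi[OF u(1-4)] keyi[OF v(1-4)] by simp
        have "i \<le> k" "1 \<le> i" "i' \<le> k" "1 \<le> i'" using u(1) v(1) by auto
        then have "\<not> j < j'" "\<not> j' < j" using lt[of i i' j j'] lt[of i' i j' j] e by linarith+
        then have "j = j'" by simp
        then have "i = i'" using e by simp
        then show ?thesis using \<open>j = j'\<close> u(5) v(5) by simp
      qed
    qed
  qed
  define c where "c v = card {x \<in> V. key x \<le> key v}" for v
  have cV: "bij_betw c V {1..card V}" and mono: "\<And>u v. u \<in> V \<Longrightarrow> v \<in> V \<Longrightarrow> key u < key v \<Longrightarrow> c u < c v"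
    using rank_labeling[OF finite_V inj] unfolding c_def by auto
  have cb: "c (f b j) = l b + 1 - j" if j: "j \<le> l b" for j
  proof -
    have "{x \<in> V. key x \<le> key (f b j)} = f b ` {j..l b}"
    proof (intro equalityI subsetI)
      fix x assume x: "x \<in> {x \<in> V. key x \<le> key (f b j)}"
      then have "x \<in> V" by simp
      from this b(1) show "x \<in> f b ` {j..l b}"
      proof (cases rule: V_cases_leg)
        case (1 j')
        then have "l b - j' \<le> l b - j" using x keyb[OF j] keyb[OF 1(1)] by simp
        then have "j \<le> j'" using j by arith
        then show ?thesis using 1 by simp
      next
        case (2 i j')
        then show ?thesis using x keyb[OF j] keyi[OF 2(1-4)] by simp
      qed
    next
      fix x assume "x \<in> f b ` {j..l b}"
      then obtain j' where "j \<le> j'" "j' \<le> l b" "x = f b j'" by auto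
      then show "x \<in> {x \<in> V. key x \<le> key (f b j)}" using keyb[OF j] keyb[of j'] b(1) by simp
    qed
    moreover have "inj_on (f b) {j..l b}" by (rule inj_on_subset[OF inj_leg[OF b(1)]]) auto
    ultimately show ?thesis unfolding c_def by (simp add: card_image)
  qed
  have other: "l b + 1 < c (f i j)" if "i \<in> {1..k}" "i \<noteq> b" "1 \<le> j" "j \<le> l i" for i j
  proof -
    have "key (f b 0) < key (f i j)" using keyb[of 0] keyi[OF that] that by simp
    then have "c (f b 0) < c (f i j)" using mono b(1) that by simp
    then show ?thesis using cb[of 0] by simp
  qed
  have mono_i: "c (f i j) < c (f i' j')"
    if "i \<in> {1..k}" "i' \<in> {1..k}" "i \<noteq> b" "i' \<noteq> b" "1 \<le> j" "j < j'" "j \<le> l i" "j' \<le> l i'" for i i' j j'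
  proof -
    have "key (f i j) < key (f i' j')"
      using keyi[OF that(1,3,5,7)] keyi[OF that(2,4) _ that(8)] lt[of i i' j j'] that by simp
    then show ?thesis using mono that by simp
  qed
  have up: "c (f i j) \<le> l b + 1 + (\<Sum>e\<in>{1..k} - {b}. min (l e) j)"
    if i: "i \<in> {1..k}" "i \<noteq> b" "1 \<le> j" "j \<le> l i" for i j
  proof -
    have "{x \<in> V. key x \<le> key (f i j)} \<subseteq> f b ` {0..l b} \<union> rest ({1..k} - {b}) j"
    proof
      fix x assume x: "x \<in> {x \<in> V. key x \<le> key (f i j)}"
      then have "x \<in> V" by simp
      from this b(1) show "x \<in> f b ` {0..l b} \<union> rest ({1..k} - {b}) j"
      proof (cases rule: V_cases_leg)
        case (1 j') then show ?thesis by simp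
      next
        case (2 i' j')
        have "\<not> j < j'"
        proof
          assume "j < j'"
          moreover have "i \<le> k" "1 \<le> i'" using i 2 by auto
          ultimately show False using lt[of i i' j j'] x keyi[OF i] keyi[OF 2(1-4)] 2(5) by simp
        qed
        then have "(i', j') \<in> (SIGMA e:{1..k} - {b}. {1..min (l e) j})" using 2 by simp
        then show ?thesis unfolding rest_def 2(5) by force
      qed
    qed
    then have "c (f i j) \<le> card (f b ` {0..l b} \<union> rest ({1..k} - {b}) j)"
      unfolding c_def by (intro card_mono) (auto simp: rest_def intro!: finite_imageI finite_SigmaI)
    also have "\<dots> \<le> card (f b ` {0..l b}) + card (rest ({1..k} - {b}) j)" by (rule card_Un_le)
    also have "\<dots> = l b + 1 + (\<Sum>e\<in>{1..k} - {b}. min (l e) j)"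
      using card_leg[OF b(1) order_refl] card_rest[of "{1..k} - {b}" j] by simp
    finally show ?thesis .
  qed
  have one: "1 \<in> {1..k}" "1 \<le> l 1" using k_ge l_pos[of 1] by auto
  have c1: "c (f 1 1) = l b + 2"
  proof -
    have "{x \<in> V. key x \<le> key (f 1 1)} \<subseteq> insert (f 1 1) (f b ` {0..l b})"
    proof
      fix x assume x: "x \<in> {x \<in> V. key x \<le> key (f 1 1)}"
      then have "x \<in> V" by simp
      from this b(1) show "x \<in> insert (f 1 1) (f b ` {0..l b})"
      proof (cases rule: V_cases_leg)
        case (2 i j)
        have le: "j * (k + 1) + i \<le> k + 2"
          using x keyi[OF 2(1-4)] keyi[OF one(1) b(2)[symmetric] _ one(2)] 2(5) by simp
        have "j = 1"
        proof (rule ccontr)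
          assume "j \<noteq> 1"
          then have "1 < j" using 2 by simp
          moreover have "1 \<le> i" using 2 by simp
          ultimately show False using lt[of k i 1 j] le k_ge by simp
        qed
        then have "i = 1" using le 2 by simp
        then show ?thesis using 2 \<open>j = 1\<close> by simp
      qed simp
    qed
    then have "c (f 1 1) \<le> card (insert (f 1 1) (f b ` {0..l b}))"
      unfolding c_def by (intro card_mono) auto
    also have "\<dots> \<le> Suc (card (f b ` {0..l b}))" by (rule card_insert_le_m1) simp_all
    also have "\<dots> = l b + 2" using card_leg[OF b(1) order_refl] by simp
    finally show ?thesis using other[OF one(1) b(2)[symmetric] order_refl one(2)] by simp
  qed
  show thesis by (rule that[OF cV cb c1 mono_i other up])
qed

text \<open>The number of vertices outside leg \<open>b\<close> at distance 1 to \<open>h\<close>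
  from the body.\<close>

definition level_sum :: "nat \<Rightarrow> nat \<Rightarrow> nat" where
  "level_sum b h = (\<Sum>e\<in>{1..k} - {b}. min (l e) h)"

text \<open>From \<open>f b p\<close>, label distance equals graph distance on leg \<open>b\<close>
  and grows with depth elsewhere. Only an off-leg vertex of depth \<open>h\<close> against a farther
  vertex \<open>f b j\<close> can fail; its label distance is at most
  \<open>p + level_sum b h\<close>, against \<open>j - p\<close>. For the leaf \<open>f 1 1\<close>
  the same comparison reads \<open>level_sum b h - 1 <= h + 2\<close>. As \<open>level_sum\<close>
  counts the leaf itself, \<open>h + 3\<close> matches the bound \<open>h + 2\<close> of
  \<open>cross_leaf\<close>.\<close>

lemma labeled_consistent:
  assumes b: "b \<in> {1..k}" "b \<noteq> 1"
  obtains c where "bij_betw c V {1..card V}"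
    "\<And>p. p \<le> l b \<Longrightarrow> (\<And>h j. 1 \<le> h \<Longrightarrow> j \<le> l b \<Longrightarrow> p + h < j - p \<Longrightarrow> p + level_sum b h \<le> j - p) \<Longrightarrow>
      consistent_at (\<lambda>v. int (c v)) (f b p)"
    "l 1 = 1 \<Longrightarrow> (\<And>h. 1 \<le> h \<Longrightarrow> h < l b \<Longrightarrow> level_sum b h \<le> h + 3) \<Longrightarrow> consistent_at (\<lambda>v. int (c v)) (f 1 1)"
proof (rule outward_labeling[OF b])
  fix c assume c: "bij_betw c V {1..card V}"
    and cb: "\<And>j. j \<le> l b \<Longrightarrow> c (f b j) = l b + 1 - j"
    and c1: "c (f 1 1) = l b + 2"
    and mono: "\<And>i j i' j'. i \<in> {1..k} \<Longrightarrow> i' \<in> {1..k} \<Longrightarrow> i \<noteq> b \<Longrightarrow> i' \<noteq> b \<Longrightarrow> 1 \<le> j \<Longrightarrow> j < j' \<Longrightarrow>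
      j \<le> l i \<Longrightarrow> j' \<le> l i' \<Longrightarrow> c (f i j) < c (f i' j')"
    and gt: "\<And>i j. i \<in> {1..k} \<Longrightarrow> i \<noteq> b \<Longrightarrow> 1 \<le> j \<Longrightarrow> j \<le> l i \<Longrightarrow> l b + 1 < c (f i j)"
    and up': "\<And>i j. i \<in> {1..k} \<Longrightarrow> i \<noteq> b \<Longrightarrow> 1 \<le> j \<Longrightarrow> j \<le> l i \<Longrightarrow>
      c (f i j) \<le> l b + 1 + (\<Sum>e\<in>{1..k} - {b}. min (l e) j)"
  note up = up'[folded level_sum_def]
  have one: "1 \<in> {1..k}" "1 \<noteq> b" "1 \<le> l 1" using k_ge l_pos[of 1] b by auto
  have low: "l b + 1 + j \<le> c (f i j)" if i: "i \<in> {1..k}" "i \<noteq> b" and "1 \<le> j" "j \<le> l i" for i j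
    using that(3,4)
  proof (induction j rule: dec_induct)
    case base then show ?case using gt[OF i] by fastforce
  next
    case (step n)
    then show ?case using mono[OF i(1) i(1) i(2) i(2), of n "Suc n"] by simp
  qed
  have main: "consistent_at (\<lambda>v. int (c v)) (f b p)"
    if p: "p \<le> l b" and slack: "\<And>h j. 1 \<le> h \<Longrightarrow> j \<le> l b \<Longrightarrow> p + h < j - p \<Longrightarrow> p + level_sum b h \<le> j - p" for p
    unfolding consistent_at_def
  proof (intro ballI impI)
    fix v v' assume V: "v \<in> V" "v' \<in> V" and dd: "d (f b p) v < d (f b p) v'"
    have cp: "int (c (f b p)) = int (l b) + 1 - int p" using cb[OF p] p by (simp add: of_nat_diff)
    have leg: "\<bar>int (c (f b p)) - int (c (f b j))\<bar> = int (d (f b p) (f b j))" if "j \<le> l b" for j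
      using cb[OF that] cp that d_f[OF b(1) b(1) p that] by (auto simp: of_nat_diff)
    have off: "d (f b p) (f i j) = p + j" "int (p + j) \<le> int (c (f i j)) - int (c (f b p))"
      if "i \<in> {1..k}" "i \<noteq> b" "1 \<le> j" "j \<le> l i" for i j
      using d_f[OF b(1) that(1) p that(4)] low[OF that] that cp by auto
    from V(1) b(1) show "\<bar>int (c (f b p)) - int (c v)\<bar> \<le> \<bar>int (c (f b p)) - int (c v')\<bar>"
    proof (cases rule: V_cases_leg)
      case v: (1 j)
      from V(2) b(1) show ?thesis
      proof (cases rule: V_cases_leg)
        case v': (1 j')
        then show ?thesis using v leg[OF v(1)] leg[OF v'(1)] dd by simp
      next
        case v': (2 i' j')
        then show ?thesis using v leg[OF v(1)] off[OF v'(1-4)] dd by simp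
      qed
    next
      case v: (2 i h)
      from V(2) b(1) show ?thesis
      proof (cases rule: V_cases_leg)
        case v': (1 j)
        have dj: "d (f b p) (f b j) = (p - j) + (j - p)" using d_f[OF b(1) b(1) p v'(1)] by simp
        \<comment> \<open>A vertex of leg \<open>b\<close> on the body's side is within
          \<open>p\<close> of \<open>f b p\<close>, nearer than anything off the leg, so
          \<open>f b j\<close> lies on the outer side.\<close>
        have "p + h < j - p" using dd v v' off(1)[OF v(1-4)] dj by simp
        moreover from this have "p + level_sum b h \<le> j - p" by (rule slack[OF v(3) v'(1)])
        ultimately show ?thesis
          using up[OF v(1-4)] off(2)[OF v(1-4)] leg[OF v'(1)] dj v(5) v'(2) cp by simp
      next
        case v': (2 i' h')
        have "h < h'" using dd v(5) v'(5) off(1)[OF v(1-4)] off(1)[OF v'(1-4)] by simp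
        then have "c (f i h) < c (f i' h')" using mono[OF v(1) v'(1) v(2) v'(2) v(3) _ v(4) v'(4)] by simp
        then show ?thesis using off(2)[OF v(1-4)] off(2)[OF v'(1-4)] v(5) v'(5) by simp
      qed
    qed
  qed
  have leaf: "consistent_at (\<lambda>v. int (c v)) (f 1 1)"
    if l1: "l 1 = 1" and slack: "\<And>h. 1 \<le> h \<Longrightarrow> h < l b \<Longrightarrow> level_sum b h \<le> h + 3"
    unfolding consistent_at_def
  proof (intro ballI impI)
    fix v v' assume V: "v \<in> V" "v' \<in> V" and dd: "d (f 1 1) v < d (f 1 1) v'"
    have leg: "\<bar>int (c (f 1 1)) - int (c (f b j))\<bar> = int j + 1" "d (f 1 1) (f b j) = j + 1" if "j \<le> l b" for j
      using cb[OF that] c1 that d_f[OF one(1) b(1) one(3) that] b by (auto simp: of_nat_diff)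
    have off: "i = 1 \<and> h = 1 \<or> d (f 1 1) (f i h) = h + 1 \<and> int h \<le> int (c (f i h)) - int (c (f 1 1))"
      if "i \<in> {1..k}" "i \<noteq> b" "1 \<le> h" "h \<le> l i" for i h
    proof (cases "i = 1")
      case False
      then have "f i 1 \<noteq> f 1 1" using f_eq[OF that(1) one(1) _ one(3), of 1] that by simp
      moreover have "f i 1 \<in> V" "f 1 1 \<in> V" using that one by auto
      ultimately have "c (f i 1) \<noteq> c (f 1 1)" using c unfolding bij_betw_def inj_on_def by blast
      moreover have "l b + 2 \<le> c (f i 1)" using low[OF that(1,2), of 1] that by simp
      ultimately have i1: "l b + 3 \<le> c (f i 1)" using c1 by simp
      have "l b + 2 + h \<le> c (f i h)" using that(3,4)
      proof (induction h rule: dec_induct)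
        case base then show ?case using i1 by simp
      next
        case (step n)
        then show ?case using mono[OF that(1,1,2,2), of n "Suc n"] by simp
      qed
      then show ?thesis using c1 False d_f[OF one(1) that(1) one(3) that(4)] by simp
    qed (use that l1 in simp)
    have zero: "d (f 1 1) (f 1 1) = 0" using d_f[OF one(1) one(1) one(3) one(3)] by simp
    from V(1) b(1) show "\<bar>int (c (f 1 1)) - int (c v)\<bar> \<le> \<bar>int (c (f 1 1)) - int (c v')\<bar>"
    proof (cases rule: V_cases_leg)
      case v: (1 j)
      from V(2) b(1) show ?thesis
      proof (cases rule: V_cases_leg)
        case v': (1 j')
        then show ?thesis using v leg[OF v(1)] leg[OF v'(1)] dd by simp
      next
        case v': (2 i' h')
        then show ?thesis using v leg[OF v(1)] off[OF v'(1-4)] dd zero by auto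
      qed
    next
      case v: (2 i h)
      show ?thesis
      proof (cases "i = 1 \<and> h = 1")
        case True then show ?thesis using v by simp
      next
        case False
        then have o: "d (f 1 1) v = h + 1" "int h \<le> int (c v) - int (c (f 1 1))" using off[OF v(1-4)] v(5) by auto
        from V(2) b(1) show ?thesis
        proof (cases rule: V_cases_leg)
          case v': (1 j)
          then have "h < j" using dd o leg[OF v'(1)] by simp
          then have "level_sum b h \<le> h + 3" using slack[OF v(3)] v'(1) by simp
          then have "c v \<le> l b + h + 4" using up[OF v(1-4)] v(5) by simp
          then show ?thesis using o leg[OF v'(1)] v' c1 \<open>h < j\<close> by simp
        next
          case v': (2 i' h')
          have "\<not> (i' = 1 \<and> h' = 1)" using dd zero v'(5) by auto
          then have o': "d (f 1 1) v' = h' + 1" "int h' \<le> int (c v') - int (c (f 1 1))"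
            using off[OF v'(1-4)] v'(5) by auto
          then have "h < h'" using dd o by simp
          then have "c v < c v'" using mono[OF v(1) v'(1) v(2) v'(2) v(3) _ v(4) v'(4)] v(5) v'(5) by simp
          then show ?thesis using o o' by simp
        qed
      qed
    qed
  qed
  show thesis by (rule that[OF c main leaf])
qed

lemma lower_count:
  assumes b: "b \<in> {1..k}" "b \<noteq> 1" and p: "p0 \<le> l b"
    and slack: "\<And>p h j. p0 \<le> p \<Longrightarrow> 1 \<le> h \<Longrightarrow> j \<le> l b \<Longrightarrow> p + h < j - p \<Longrightarrow> p + level_sum b h \<le> j - p"
  shows "\<exists>c. bij_betw c V {1..card V} \<and> l b - p0 + 1 \<le> card (consistent_set (\<lambda>v. int (c v)))"
    and "l 1 = 1 \<Longrightarrow> (\<And>h. 1 \<le> h \<Longrightarrow> h < l b \<Longrightarrow> level_sum b h \<le> h + 3) \<Longrightarrow>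
      \<exists>c. bij_betw c V {1..card V} \<and> l b - p0 + 2 \<le> card (consistent_set (\<lambda>v. int (c v)))"
proof -
  have one: "1 \<in> {1..k}" "1 \<noteq> b" "1 \<le> l 1" using k_ge l_pos[of 1] b by auto
  have inj: "inj_on (f b) {p0..l b}" by (rule inj_on_subset[OF inj_leg[OF b(1)]]) auto
  have "\<exists>c. bij_betw c V {1..card V} \<and> f b ` {p0..l b} \<subseteq> consistent_set (\<lambda>v. int (c v)) \<and>
    (l 1 = 1 \<and> (\<forall>h. 1 \<le> h \<and> h < l b \<longrightarrow> level_sum b h \<le> h + 3) \<longrightarrow> f 1 1 \<in> consistent_set (\<lambda>v. int (c v)))"
  proof (rule labeled_consistent[OF b])
    fix c assume c: "bij_betw c V {1..card V}"
      and main: "\<And>p. p \<le> l b \<Longrightarrow> (\<And>h j. 1 \<le> h \<Longrightarrow> j \<le> l b \<Longrightarrow> p + h < j - p \<Longrightarrow> p + level_sum b h \<le> j - p) \<Longrightarrow>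
        consistent_at (\<lambda>v. int (c v)) (f b p)"
      and leaf: "l 1 = 1 \<Longrightarrow> (\<And>h. 1 \<le> h \<Longrightarrow> h < l b \<Longrightarrow> level_sum b h \<le> h + 3) \<Longrightarrow> consistent_at (\<lambda>v. int (c v)) (f 1 1)"
    have "f b ` {p0..l b} \<subseteq> consistent_set (\<lambda>v. int (c v))"
    proof
      fix x assume "x \<in> f b ` {p0..l b}"
      then obtain p where p: "p0 \<le> p" "p \<le> l b" "x = f b p" by auto
      have "consistent_at (\<lambda>v. int (c v)) (f b p)" by (rule main[OF p(2) slack[OF p(1)]])
      then show "x \<in> consistent_set (\<lambda>v. int (c v))" using p b(1) unfolding consistent_set_def by simp
    qed
    moreover have "f 1 1 \<in> consistent_set (\<lambda>v. int (c v))"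
      if "l 1 = 1" "\<forall>h. 1 \<le> h \<and> h < l b \<longrightarrow> level_sum b h \<le> h + 3"
    proof -
      have "consistent_at (\<lambda>v. int (c v)) (f 1 1)" by (rule leaf) (use that in auto)
      then show ?thesis using one unfolding consistent_set_def by simp
    qed
    ultimately show ?thesis using c by blast
  qed
  then obtain c where c: "bij_betw c V {1..card V}"
    and sub: "f b ` {p0..l b} \<subseteq> consistent_set (\<lambda>v. int (c v))"
    and leaf: "l 1 = 1 \<Longrightarrow> \<forall>h. 1 \<le> h \<and> h < l b \<longrightarrow> level_sum b h \<le> h + 3 \<Longrightarrow> f 1 1 \<in> consistent_set (\<lambda>v. int (c v))"
    by blast
  have fin: "finite (consistent_set (\<lambda>v. int (c v)))" unfolding consistent_set_def by simp
  have cd: "card (f b ` {p0..l b}) = l b - p0 + 1" using inj p by (simp add: card_image)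
  show "\<exists>c. bij_betw c V {1..card V} \<and> l b - p0 + 1 \<le> card (consistent_set (\<lambda>v. int (c v)))"
    using c card_mono[OF fin sub] cd by auto
  show "\<exists>c. bij_betw c V {1..card V} \<and> l b - p0 + 2 \<le> card (consistent_set (\<lambda>v. int (c v)))"
    if l1: "l 1 = 1" "\<And>h. 1 \<le> h \<Longrightarrow> h < l b \<Longrightarrow> level_sum b h \<le> h + 3"
  proof -
    have "f 1 1 \<in> consistent_set (\<lambda>v. int (c v))" using leaf l1 by blast
    then have "insert (f 1 1) (f b ` {p0..l b}) \<subseteq> consistent_set (\<lambda>v. int (c v))" using sub by blast
    from card_mono[OF fin this] have "card (insert (f 1 1) (f b ` {p0..l b})) \<le> card (consistent_set (\<lambda>v. int (c v)))" .
    moreover have "f 1 1 \<noteq> f b j" if "j \<le> l b" for j using f_eq[OF one(1) b(1) one(3) that] one(2) by simp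
    then have "f 1 1 \<notin> f b ` {p0..l b}" by (metis atLeastAtMost_iff imageE)
    ultimately have "l b - p0 + 2 \<le> card (consistent_set (\<lambda>v. int (c v)))" using cd by simp
    then show ?thesis using c by blast
  qed
qed

lemma lower_bound: "\<exists>c. bij_betw c V {1..card V} \<and> ldc_value \<le> card (consistent_set (\<lambda>v. int (c v)))"
proof -
  have kk: "k \<in> {1..k}" "k \<noteq> 1" "2 \<in> {1..k}" "1 \<in> {1..k}" using k_ge by auto
  note lp = l_pos[OF kk(1)] l_pos[OF kk(3)] l_pos[OF kk(4)]
  have half: "\<exists>c. bij_betw c V {1..card V} \<and> (l b + 1) div 2 + 1 \<le> card (consistent_set (\<lambda>v. int (c v)))"
    "l 1 = 1 \<Longrightarrow> (\<And>h. 1 \<le> h \<Longrightarrow> h < l b \<Longrightarrow> level_sum b h \<le> h + 3) \<Longrightarrow>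
      \<exists>c. bij_betw c V {1..card V} \<and> (l b + 1) div 2 + 2 \<le> card (consistent_set (\<lambda>v. int (c v)))"
    if b: "b \<in> {1..k}" "b \<noteq> 1" for b
  proof -
    \<comment> \<open>From half the leg on, \<open>2 * p + h < j\<close> is impossible for
      \<open>h >= 1\<close>, so the slack condition is vacuous whatever the other legs are.\<close>
    have *: "p + level_sum b h \<le> j - p" if "l b div 2 \<le> p" "1 \<le> h" "j \<le> l b" "p + h < j - p" for p h j
      using that by linarith
    have e: "l b - l b div 2 = (l b + 1) div 2" by linarith
    have "l b div 2 \<le> l b" by simp
    note lc = lower_count[OF b this *]
    show "\<exists>c. bij_betw c V {1..card V} \<and> (l b + 1) div 2 + 1 \<le> card (consistent_set (\<lambda>v. int (c v)))"
      using lc(1) unfolding e .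
    show "l 1 = 1 \<Longrightarrow> (\<And>h. 1 \<le> h \<Longrightarrow> h < l b \<Longrightarrow> level_sum b h \<le> h + 3) \<Longrightarrow>
      \<exists>c. bij_betw c V {1..card V} \<and> (l b + 1) div 2 + 2 \<le> card (consistent_set (\<lambda>v. int (c v)))"
      using lc(2) unfolding e .
  qed
  consider (star) "l k = 1" | (short) "l k \<noteq> 1" "k = 3" "l 1 = 1" | (three) "l k \<noteq> 1" "k = 3" "l 1 \<noteq> 1"
    | (E) "l k \<noteq> 1" "4 \<le> k" "l 1 = 1" "condition_E k l"
    | (other) "l k \<noteq> 1" "4 \<le> k" "\<not> (l 1 = 1 \<and> condition_E k l)"
    using k_ge by fastforce
  then show ?thesis
  proof cases
    case star
    then have "ldc_value = (l k + 1) div 2 + 2" unfolding ldc_value_def by simp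
    moreover have "l 1 = 1" using l_last[OF kk(4)] star lp by simp
    ultimately show ?thesis using half(2)[OF kk(1,2)] star by simp
  next
    case short
    \<comment> \<open>Leg 1 contributes at most 1 and leg 2 at most \<open>h\<close>. This single
      surplus is absorbed by the strict inequality in the slack condition, so even
      \<open>p0 = 0\<close> works.\<close>
    have "level_sum k h \<le> h + 1" for h
    proof -
      have "{1..k} - {k} = {1, 2}" using short by auto
      then show ?thesis unfolding level_sum_def using short by simp
    qed
    note t = this
    have slack: "p + level_sum k h \<le> j - p" if "0 \<le> p" "1 \<le> h" "j \<le> l k" "p + h < j - p" for p h j
      using t[of h] that by linarith
    have "level_sum k h \<le> h + 3" if "1 \<le> h" "h < l k" for h using t[of h] by linarith
    from lower_count(2)[OF kk(1,2) le0 slack short(3) this]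
    have "\<exists>c. bij_betw c V {1..card V} \<and> l k - 0 + 2 \<le> card (consistent_set (\<lambda>v. int (c v)))" by blast
    then show ?thesis unfolding ldc_value_def using short by simp
  next
    case three
    \<comment> \<open>The start \<open>(l k - 1) div 2\<close> is one below half for even
      \<open>l k\<close>. The only instance of the slack condition left is \<open>h = 1\<close>,
      \<open>j = 2 * p + 2\<close>, where the two neighbours of the body on the other legs just
      fit.\<close>
    have "l k - (l k - 1) div 2 + 1 = l k div 2 + 2" using lp by linarith
    then have e: "ldc_value = l k - (l k - 1) div 2 + 1" unfolding ldc_value_def using three by simp
    have "level_sum k 1 \<le> 2"
    proof -
      have "{1..k} - {k} = {1, 2}" using three by auto
      then show ?thesis unfolding level_sum_def by simp
    qed
    note t = this
    have "p + level_sum k h \<le> j - p" if "(l k - 1) div 2 \<le> p" "1 \<le> h" "j \<le> l k" "p + h < j - p" for p h j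
    proof -
      have "h = 1" "j - p = p + 2" using that by linarith+
      then show ?thesis using t by simp
    qed
    then have "\<exists>c. bij_betw c V {1..card V} \<and> l k - (l k - 1) div 2 + 1 \<le> card (consistent_set (\<lambda>v. int (c v)))"
      by (intro lower_count(1)[OF kk(1,2)]) auto
    then show ?thesis unfolding e .
  next
    case E
    have "\<exists>b. b \<in> {1..k} \<and> b \<noteq> 1 \<and> (l b + 1) div 2 = (l k + 1) div 2 \<and>
      (\<forall>h. 1 \<le> h \<and> h < l b \<longrightarrow> level_sum b h \<le> h + 3)"
    proof -
      consider (a) "k = 4" "l 2 \<le> 2" | (b) "k = 4" "l 2 = 3" "l 4 \<le> 4" | (c) "k = 5" "l 3 = 1"
        | (d) "k = 5" "l 5 = 2" | (e) "l 2 = 1" "l k = 2"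
        using E(4) unfolding condition_E_def by blast
      then show ?thesis
      proof cases
        case a
        have "{1..k} - {4} = {1, 2, 3}" using a by auto
        then have "level_sum 4 h \<le> h + 3" for h unfolding level_sum_def using a E by simp
        then show ?thesis using kk a by blast
      next
        \<comment> \<open>Leg 2 of length 3 is used: its half rounds up to the same value as that of
          a leg of length 4, and only \<open>h <= 2\<close> must be checked. On leg 4 of length 4,
          \<open>h = 3\<close> would give \<open>1 + 3 + 3 > 6\<close>.\<close>
        case b
        have "{1..k} - {2} = {1, 3, 4}" using b by auto
        then have "level_sum 2 h \<le> h + 3" if "h < 3" for h unfolding level_sum_def using that E by simp
        moreover have "l 4 = 3 \<or> l 4 = 4" using l_last[OF kk(3)] b by auto
        then have "(l 2 + 1) div 2 = (l k + 1) div 2" using b by auto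
        ultimately show ?thesis using kk(3) b by (intro exI[of _ 2]) auto
      next
        case c
        have "{1..k} - {5} = {1, 2, 3, 4}" using c by auto
        moreover have "l 2 \<le> 1" using l_mono[of 2 3] c by simp
        ultimately have "level_sum 5 h \<le> h + 3" for h unfolding level_sum_def using c E by simp
        then show ?thesis using kk c by blast
      next
        case d
        have "{1..k} - {5} = {1, 2, 3, 4}" using d by auto
        then have "level_sum 5 1 \<le> 4" unfolding level_sum_def by simp
        moreover have "h = 1" if "1 \<le> h" "h < l 5" for h using d that by simp
        ultimately have "\<forall>h. 1 \<le> h \<and> h < l 5 \<longrightarrow> level_sum 5 h \<le> h + 3" by fastforce
        then show ?thesis using kk d by blast
      next
        \<comment> \<open>Leg 2 has length 1, so no \<open>h\<close> needs checking, and lengths 1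
          and 2 round up to the same half.\<close>
        case e
        then show ?thesis using kk(3) by (intro exI[of _ 2]) auto
      qed
    qed
    then obtain b where "b \<in> {1..k}" "b \<noteq> 1" "(l b + 1) div 2 = (l k + 1) div 2"
      "\<forall>h. 1 \<le> h \<and> h < l b \<longrightarrow> level_sum b h \<le> h + 3" by blast
    then show ?thesis using half(2)[of b] E unfolding ldc_value_def by simp
  next
    case other
    then show ?thesis using half(1)[OF kk(1,2)] unfolding ldc_value_def by auto
  qed
qed

end

subsection \<open>Coordinates of a spider\<close>

context pair_graph begin

lemma out_degree_eq_card: "out_degree (with_proj G) v = card {u. (v, u) \<in> parcs G}"
proof -
  have "out_arcs (with_proj G) v = Pair v ` {u. (v, u) \<in> parcs G}"
    unfolding out_arcs_def by auto
  then show ?thesis unfolding out_degree_def by (simp add: card_image inj_on_def)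
qed

lemma finite_neighbours: "finite {u. (v, u) \<in> parcs G}"
  by (rule finite_subset[OF _ pair_finite_verts]) (auto dest: in_arcsD2)

lemma awalk_of_sequence:
  assumes "x 0 \<in> pverts G" and "\<And>i. i < m \<Longrightarrow> (x i, x (Suc i)) \<in> parcs G"
  shows "awalk (x 0) (map (\<lambda>i. (x i, x (Suc i))) [0..<m]) (x m)"
  using assms(2)
proof (induction m)
  case 0 then show ?case using assms(1) by (simp add: awalk_Nil_iff)
next
  case (Suc m)
  have e: "(x m, x (Suc m)) \<in> parcs G" using Suc.prems by simp
  have "awalk (x 0) (map (\<lambda>i. (x i, x (Suc i))) [0..<m]) (x m)" using Suc by simp
  moreover have "awalk (x m) [(x m, x (Suc m))] (x (Suc m))"
    using e in_arcsD2[OF e] by (simp add: awalk_Cons_iff awalk_Nil_iff)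
  ultimately show ?case by (simp del: awalk_append_iff add: awalk_appendI)
qed

text \<open>Bridges from vertex sequences to the arc lists in terms of which cycles are
  defined.\<close>

lemma no_closed_sequence:
  assumes acyc: "\<not> (\<exists>p. pre_digraph.cycle (with_proj G) p \<and> length p \<ge> 3)"
    and m: "3 \<le> m" and e: "\<And>i. i < m \<Longrightarrow> (x i, x (Suc i)) \<in> parcs G"
    and closed: "x m = x 0" and inj: "inj_on x {..<m}"
  shows False
proof -
  define p where "p = map (\<lambda>i. (x i, x (Suc i))) [0..<m]"
  have ne: "p \<noteq> []" unfolding p_def using m by simp
  have x0: "x 0 \<in> pverts G" using in_arcsD1[OF e[of 0]] m by simp
  have aw: "awalk (x 0) p (x 0)" using awalk_of_sequence[of x, where m = m, OF x0] e unfolding p_def closed by blast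
  have cas: "pcas (x 0) p (x 0)" using aw by (rule awalkE')
  have "awalk_verts (x 0) p = fst (hd p) # map snd p"
    using awalk_verts_conv'[of "x 0" p "x 0"] cas ne by simp
  then have "tl (awalk_verts (x 0) p) = map (\<lambda>i. x (Suc i)) [0..<m]"
    unfolding p_def by simp
  moreover have "distinct (map (\<lambda>i. x (Suc i)) [0..<m])"
  proof -
    have "inj_on (\<lambda>i. x (Suc i)) {0..<m}"
    proof (rule inj_onI)
      fix i j assume ij: "i \<in> {0..<m}" "j \<in> {0..<m}" "x (Suc i) = x (Suc j)"
      \<comment> \<open>The tail of the vertex list runs over \<open>x 1\<close> to
        \<open>x m\<close>, so index \<open>m\<close> is folded back to 0 before injectivity on
        \<open>{..<m}\<close> applies.\<close>
      have "x (if Suc i = m then 0 else Suc i) = x (if Suc j = m then 0 else Suc j)"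
        using ij(3) closed by (auto split: if_splits)
      then have "(if Suc i = m then 0 else Suc i) = (if Suc j = m then 0 else Suc j)"
        using inj_onD[OF inj] ij m by (simp split: if_splits)
      then show "i = j" by (auto split: if_splits)
    qed
    then show ?thesis by (simp add: distinct_map)
  qed
  ultimately have "cycle p" unfolding cycle_def using aw ne by auto
  moreover have "3 \<le> length p" unfolding p_def using m by simp
  ultimately show False using acyc by blast
qed

text \<open>\<open>h\<close> is a certificate for the distance from \<open>u\<close>: growing by at
  most 1 along arcs makes it a lower bound on every walk, and descent to \<open>u\<close> yields a
  walk of that length.\<close>

lemma graph_dist_eqI:
  fixes h :: "'a \<Rightarrow> nat"
  assumes u: "u \<in> pverts G" "h u = 0"
    and lip: "\<And>x y. (x, y) \<in> parcs G \<Longrightarrow> h y \<le> h x + 1"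
    and desc: "\<And>v. v \<in> pverts G \<Longrightarrow> 0 < h v \<Longrightarrow> \<exists>y. (y, v) \<in> parcs G \<and> h y + 1 = h v"
    and zero: "\<And>v. v \<in> pverts G \<Longrightarrow> h v = 0 \<Longrightarrow> v = u"
    and v: "v \<in> pverts G"
  shows "graph_dist G u v = ereal (h v)"
proof (rule antisym)
  have "\<exists>p. awalk u p v \<and> length p = m" if "h v = m" "v \<in> pverts G" for m v
    using that
  proof (induction m arbitrary: v)
    case 0 then show ?case using zero u by (auto simp: awalk_Nil_iff intro!: exI[of _ "[]"])
  next
    case (Suc m)
    obtain y where y: "(y, v) \<in> parcs G" "h y + 1 = h v" using desc[of v] Suc.prems by force
    then obtain p where p: "awalk u p y" "length p = m" using Suc.IH[of y] Suc.prems in_arcsD1 by auto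
    have "awalk y [(y, v)] v" using y in_arcsD2[OF y(1)] by (simp add: awalk_Cons_iff awalk_Nil_iff)
    then have "awalk u (p @ [(y, v)]) v" using p by (blast intro: awalk_appendI)
    then show ?case using p by (intro exI[of _ "p @ [(y, v)]"]) simp
  qed
  then obtain p where p: "awalk u p v" "length p = h v" using v by blast
  have cost: "awalk_cost (\<lambda>_. 1) p = length p" for p by (induction p) simp_all
  show "graph_dist G u v \<le> ereal (h v)"
    unfolding graph_dist_def using min_cost_le_walk_cost[OF p(1), of "\<lambda>_. 1"] p(2) cost by simp
  have "h v' \<le> h u' + length p" if "awalk u' p v'" for u' v' p
    using that
  proof (induction p arbitrary: u')
    case Nil then show ?case by (simp add: awalk_Nil_iff)
  next
    case (Cons e p)
    obtain y where e: "e = (u', y)" "(u', y) \<in> parcs G" "awalk y p v'"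
      using Cons.prems by (cases e) (auto simp: awalk_Cons_iff)
    then show ?case using Cons.IH[of y] lip[of u' y] by simp
  qed
  then have "ereal (h v) \<le> ereal (awalk_cost (\<lambda>_. 1) p)" if "awalk u p v" for p
    using that u(2) cost by fastforce
  then show "ereal (h v) \<le> graph_dist G u v"
    unfolding graph_dist_def \<mu>_def by (intro INF_greatest) auto
qed

end

section \<open>Legs as paths leaving the body\<close>

locale spider_graph = pair_graph G for G :: "'a pair_pre_digraph" + fixes w :: 'a
  assumes tree: "undirected_tree G" and w: "w \<in> pverts G"
    and deg: "v \<in> pverts G \<Longrightarrow> v \<noteq> w \<Longrightarrow> out_degree (with_proj G) v \<le> 2"
begin

definition N :: "'a \<Rightarrow> 'a set" where
  "N v = {u. (v, u) \<in> parcs G}"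

lemma N_sym: "u \<in> N v \<longleftrightarrow> v \<in> N u"
  unfolding N_def using arcs_symmetric by blast

lemma N_in_verts: "u \<in> N v \<Longrightarrow> u \<in> pverts G"
  unfolding N_def using in_arcsD2 by blast

lemma not_N_self: "v \<notin> N v"
  unfolding N_def using no_loops' by blast

lemma card_N: "v \<in> pverts G \<Longrightarrow> v \<noteq> w \<Longrightarrow> card (N v) \<le> 2"
  using deg unfolding out_degree_eq_card N_def by blast

lemma finite_N [simp]: "finite (N v)"
  unfolding N_def by (rule finite_neighbours)

text \<open>The path leaving the body through its neighbour \<open>a\<close>; its values are arbitrary past the end of the leg.\<close>

fun path :: "'a \<Rightarrow> nat \<Rightarrow> 'a" where
  "path a 0 = w"
| "path a (Suc 0) = a"
| "path a (Suc (Suc n)) = (SOME z. z \<in> N (path a (Suc n)) \<and> z \<noteq> path a n)"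

text \<open>The index is shifted: \<open>stops a n\<close> says that the vertex at depth
  \<open>n + 1\<close> is a leaf, hence the \<open>Suc\<close> in \<open>len\<close>.\<close>

definition stops :: "'a \<Rightarrow> nat \<Rightarrow> bool" where
  "stops a n \<longleftrightarrow> N (path a (Suc n)) \<subseteq> {path a n}"

lemma path_step:
  assumes "\<not> stops a n"
  shows "path a (Suc (Suc n)) \<in> N (path a (Suc n))" "path a (Suc (Suc n)) \<noteq> path a n"
proof -
  have "\<exists>z. z \<in> N (path a (Suc n)) \<and> z \<noteq> path a n" using assms unfolding stops_def by blast
  from someI_ex[OF this]
  show "path a (Suc (Suc n)) \<in> N (path a (Suc n))" "path a (Suc (Suc n)) \<noteq> path a n" by simp_all
qed

lemma path_edge:
  assumes a: "a \<in> N w" and go: "\<And>i. Suc i < n \<Longrightarrow> \<not> stops a i" and i: "i < n"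
  shows "path a (Suc i) \<in> N (path a i)"
proof (cases i)
  case 0 then show ?thesis using a by simp
next
  case (Suc i') then show ?thesis using path_step(1)[OF go[of i']] i by simp
qed

text \<open>A repeated vertex closes a cycle. Closed lengths 1 and 2 are excluded by the absence of
  loops and by the path never turning back; only lengths from 3 on are covered by
  \<open>undirected_tree\<close>.\<close>

lemma path_inj:
  assumes a: "a \<in> N w" and go: "\<And>i. Suc i < n \<Longrightarrow> \<not> stops a i"
  shows "inj_on (path a) {..n}"
  using go
proof (induction n)
  case 0 then show ?case by simp
next
  case (Suc n)
  have IH: "inj_on (path a) {..n}" using Suc by simp
  have "path a (Suc n) \<noteq> path a i" if i: "i \<le> n" for i
  proof
    assume eq: "path a (Suc n) = path a i"
    define m where "m = Suc n - i"
    have edge: "path a (Suc j) \<in> N (path a j)" if "j \<le> n" for j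
      using path_edge[OF a, of "Suc n" j] Suc.prems that by simp
    have "m \<noteq> 0" using i m_def by simp
    moreover have "m \<noteq> 1"
    proof
      assume "m = 1"
      then have "i = n" using i m_def by simp
      then show False using edge[of n] eq not_N_self by simp
    qed
    moreover have "m \<noteq> 2"
    proof
      assume "m = 2"
      then have n: "n = Suc i" using i m_def by simp
      then show False using path_step(2)[of a i] Suc.prems[of i] eq by simp
    qed
    ultimately have m3: "3 \<le> m" by simp
    show False
    proof (rule no_closed_sequence[of m "\<lambda>j. path a (i + j)"])
      show "\<not> (\<exists>p. pre_digraph.cycle (with_proj G) p \<and> 3 \<le> length p)"
        using tree unfolding undirected_tree_def by blast
      show "(path a (i + j), path a (i + Suc j)) \<in> parcs G" if "j < m" for j
        using edge[of "i + j"] that m_def unfolding N_def by simp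
      show "path a (i + m) = path a (i + 0)" using eq i m_def by simp
      show "inj_on (\<lambda>j. path a (i + j)) {..<m}"
      proof (rule inj_onI)
        fix s t assume "s \<in> {..<m}" "t \<in> {..<m}" "path a (i + s) = path a (i + t)"
        then show "s = t" using inj_onD[OF IH, of "i + s" "i + t"] i m_def by simp
      qed
    qed (rule m3)
  qed
  then show ?case using IH by (auto simp: atMost_Suc)
qed

lemma path_stops:
  assumes a: "a \<in> N w" shows "\<exists>n. stops a n"
proof (rule ccontr)
  assume n: "\<not> (\<exists>n. stops a n)"
  have "inj (path a)"
  proof (rule injI)
    fix i j assume "path a i = path a j"
    then show "i = j" using inj_onD[OF path_inj[OF a, of "max i j"], of i j] n by auto
  qed
  moreover have "range (path a) \<subseteq> pverts G"
  proof
    fix x assume "x \<in> range (path a)"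
    then obtain i where i: "x = path a i" by blast
    show "x \<in> pverts G"
    proof (cases i)
      case 0 then show ?thesis using i w by simp
    next
      case (Suc j)
      then show ?thesis using i path_edge[OF a, of "Suc j" j] n N_in_verts by blast
    qed
  qed
  ultimately show False
    using pair_finite_verts finite_subset range_inj_infinite by blast
qed

definition len :: "'a \<Rightarrow> nat" where
  "len a = Suc (LEAST n. stops a n)"

lemma
  assumes a: "a \<in> N w"
  shows stops_len: "stops a (len a - 1)" and len_pos: "1 \<le> len a"
    and not_stops: "Suc i < len a \<Longrightarrow> \<not> stops a i"
  using LeastI_ex[OF path_stops[OF a]] not_less_Least[of i "stops a"] unfolding len_def by auto

lemma path_inj_len: "a \<in> N w \<Longrightarrow> inj_on (path a) {..len a}"
  using path_inj not_stops by blast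

lemma path_edge_len: "a \<in> N w \<Longrightarrow> i < len a \<Longrightarrow> path a (Suc i) \<in> N (path a i)"
  using path_edge not_stops by blast

lemma path_in_verts: "a \<in> N w \<Longrightarrow> i \<le> len a \<Longrightarrow> path a i \<in> pverts G"
  using w path_edge_len[of a "i - 1"] N_in_verts by (cases i) (auto simp del: path.simps(2,3))

lemma path_neq_w: "a \<in> N w \<Longrightarrow> 1 \<le> i \<Longrightarrow> i \<le> len a \<Longrightarrow> path a i \<noteq> w"
  using inj_onD[OF path_inj_len, of a i 0] by auto

text \<open>Off the body degrees are at most 2, so predecessor and successor on the path exhaust the
  neighbours.\<close>

lemma N_path:
  assumes a: "a \<in> N w" and i: "1 \<le> i" "i \<le> len a"
  shows "N (path a i) = (if i < len a then {path a (i - 1), path a (Suc i)} else {path a (i - 1)})"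
proof -
  have prev: "path a (i - 1) \<in> N (path a i)" using path_edge_len[OF a, of "i - 1"] i N_sym by simp
  show ?thesis
  proof (cases "i < len a")
    case True
    have "path a (i - 1) \<noteq> path a (Suc i)"
    proof
      assume "path a (i - 1) = path a (Suc i)"
      moreover have "i - 1 \<in> {..len a}" "Suc i \<in> {..len a}" using True by auto
      ultimately have "i - 1 = Suc i" by (rule inj_onD[OF path_inj_len[OF a]])
      then show False by simp
    qed
    then have "card {path a (i - 1), path a (Suc i)} = 2" by simp
    moreover have "{path a (i - 1), path a (Suc i)} \<subseteq> N (path a i)"
      using prev path_edge_len[OF a True] by simp
    moreover have "card (N (path a i)) \<le> 2"
      using card_N path_in_verts[OF a i(2)] path_neq_w[OF a i] by blast
    ultimately have "{path a (i - 1), path a (Suc i)} = N (path a i)"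
      by (intro card_seteq) simp_all
    then show ?thesis using True by simp
  next
    case False
    then have "i = len a" using i by simp
    then have "N (path a i) \<subseteq> {path a (i - 1)}" using stops_len[OF a] i unfolding stops_def by simp
    then show ?thesis using prev False by auto
  qed
qed

text \<open>Walking inward from a common vertex, the predecessor on one path is a neighbour and
  hence, by \<open>N_path\<close>, again on the other path; at depth 1 it is the body. The neighbour
  may a priori be the outer one on path \<open>b\<close>; injectivity settles the depths once
  \<open>a = b\<close> is known.\<close>

lemma path_disjoint:
  assumes a: "a \<in> N w" and b: "b \<in> N w"
  shows "1 \<le> i \<Longrightarrow> i \<le> len a \<Longrightarrow> 1 \<le> j \<Longrightarrow> j \<le> len b \<Longrightarrow> path a i = path b j \<Longrightarrow> a = b \<and> i = j"
proof (induction i arbitrary: j)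
  case 0 then show ?case by simp
next
  case (Suc i)
  have nb: "path a i \<in> N (path b j)" using path_edge_len[OF a, of i] Suc.prems N_sym by simp
  then obtain j' where j': "path a i = path b j'" "j' = j - 1 \<or> j' = Suc j" "j' \<le> len b"
    using N_path[OF b Suc.prems(3,4)] Suc.prems(3,4) by (auto split: if_splits)
  show ?case
  proof (cases "i = 0")
    case True
    then have "j' = 0" using j' path_neq_w[OF b, of j'] by (cases j') auto
    then have "j = 1" using j'(2) Suc.prems(3) by simp
    then show ?thesis using Suc.prems(5) True by simp
  next
    case False
    then have "1 \<le> i" "i \<le> len a" using Suc.prems by auto
    moreover have "1 \<le> j'" using j'(1) path_neq_w[OF a calculation] by (cases j') auto
    ultimately have "a = b \<and> i = j'" using Suc.IH j' by blast
    then show ?thesis using inj_onD[OF path_inj_len[OF a], of "Suc i" j] Suc.prems by auto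
  qed
qed

text \<open>By \<open>N_path\<close> no arc leaves the union of the paths, and every vertex is
  reachable from the body.\<close>

lemma verts_eq: "pverts G = {path a i | a i. a \<in> N w \<and> i \<le> len a} \<union> {w}"
proof
  show "{path a i | a i. a \<in> N w \<and> i \<le> len a} \<union> {w} \<subseteq> pverts G"
    using path_in_verts w by blast
  show "pverts G \<subseteq> {path a i | a i. a \<in> N w \<and> i \<le> len a} \<union> {w}"
  proof
    fix v assume v: "v \<in> pverts G"
    have "strongly_connected (mk_symmetric (with_proj G))"
      using tree unfolding undirected_tree_def connected_def by blast
    then have "w \<rightarrow>\<^sup>*\<^bsub>mk_symmetric (with_proj G)\<^esub> v"
      unfolding strongly_connected_def using v w by (simp add: mk_symmetric_def)
    then have "w \<rightarrow>\<^sup>*\<^bsub>with_proj G\<^esub> v" using reachable_mk_symmetric_eq[OF sym_arcs] by simp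
    then have "(w, v) \<in> (parcs G)\<^sup>*" using reachable_rtranclI[of "with_proj G"] by simp
    then show "v \<in> {path a i | a i. a \<in> N w \<and> i \<le> len a} \<union> {w}"
    proof (induction rule: rtrancl_induct)
      case base then show ?case by simp
    next
      case (step y z)
      have z: "z \<in> N y" using step unfolding N_def by simp
      show ?case
      proof (cases "y = w")
        case True
        then have "z = path z 1" "z \<in> N w" using z by simp_all
        then show ?thesis using len_pos by blast
      next
        case False
        then obtain a i where ai: "a \<in> N w" "i \<le> len a" "y = path a i" using step.IH by blast
        then have i: "1 \<le> i" using False by (cases i) auto
        have "z = path a (i - 1) \<or> z = path a (Suc i) \<and> Suc i \<le> len a"
          using z N_path[OF ai(1) i ai(2)] unfolding ai(3) by (auto split: if_splits)
        moreover have "i - 1 \<le> len a" using ai by simp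
        ultimately show ?thesis using ai(1) by blast
      qed
    qed
  qed
qed

definition leg :: "'a \<Rightarrow> 'a set" where
  "leg a = path a ` {1..len a}"

lemma card_leg: "a \<in> N w \<Longrightarrow> card (leg a) = len a"
proof -
  assume a: "a \<in> N w"
  have "inj_on (path a) {1..len a}" by (rule inj_on_subset[OF path_inj_len[OF a]]) auto
  then show ?thesis unfolding leg_def by (simp add: card_image)
qed

lemma inj_leg: "inj_on leg (N w)"
proof (rule inj_onI)
  fix a b assume ab: "a \<in> N w" "b \<in> N w" "leg a = leg b"
  have "path a 1 \<in> leg a" using len_pos[OF ab(1)] unfolding leg_def by (intro imageI) simp
  then have "path a 1 \<in> leg b" using ab(3) by simp
  then obtain j where "1 \<le> j" "j \<le> len b" "path a 1 = path b j" unfolding leg_def by auto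
  then show "a = b" using path_disjoint[OF ab(1,2)] len_pos[OF ab(1)] by blast
qed

text \<open>Arcs along a leg can be traversed both ways, so it is strongly connected; the only
  neighbour outside the leg that \<open>N_path\<close> admits is the body, which has been
  deleted.\<close>

lemma legs_eq: "legs G w = leg ` N w"
proof -
  define H where "H = pre_digraph.del_vert (with_proj G) w"
  interpret H: wf_digraph H unfolding H_def by (rule wf_digraph_del_vert)
  have vH: "verts H = pverts G - {w}" unfolding H_def by (simp add: del_vert_simps)
  have aH: "(x, y) \<in> arcs_ends H \<longleftrightarrow> y \<in> N x \<and> x \<noteq> w \<and> y \<noteq> w" for x y
    unfolding H_def N_def by (auto simp: arcs_ends_conv del_vert_simps)
  have reach: "path a i \<rightarrow>\<^sup>*\<^bsub>H\<^esub> path a j \<and> path a j \<rightarrow>\<^sup>*\<^bsub>H\<^esub> path a i"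
    if a: "a \<in> N w" and i: "1 \<le> i" and ij: "i \<le> j" and j: "j \<le> len a" for a i j
    using ij j
  proof (induction j rule: dec_induct)
    case base
    have "path a i \<in> verts H" using path_in_verts[OF a] path_neq_w[OF a i] base vH by simp
    then show ?case by simp
  next
    case (step n)
    have n: "1 \<le> n" "Suc n \<le> len a" using step i by auto
    have "path a (Suc n) \<in> N (path a n)" using path_edge_len[OF a] n by simp
    moreover have "path a n \<noteq> w" "path a (Suc n) \<noteq> w" using path_neq_w[OF a] n by auto
    ultimately have "(path a n, path a (Suc n)) \<in> arcs_ends H" "(path a (Suc n), path a n) \<in> arcs_ends H"
      unfolding aH using N_sym by auto
    moreover have "path a i \<rightarrow>\<^sup>*\<^bsub>H\<^esub> path a n \<and> path a n \<rightarrow>\<^sup>*\<^bsub>H\<^esub> path a i" using step by simp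
    ultimately show ?case using H.reachable_adj_trans H.adj_reachable_trans by blast
  qed
  have strong: "u \<rightarrow>\<^sup>*\<^bsub>H\<^esub> v" if a: "a \<in> N w" and uv: "u \<in> leg a" "v \<in> leg a" for a u v
  proof -
    obtain i j where ij: "1 \<le> i" "i \<le> len a" "u = path a i" "1 \<le> j" "j \<le> len a" "v = path a j"
      using uv unfolding leg_def by auto
    then show ?thesis using reach[OF a, of i j] reach[OF a, of j i] by (cases "i \<le> j") auto
  qed
  have closed: "v \<in> leg a" if r: "u \<rightarrow>\<^sup>*\<^bsub>H\<^esub> v" and a: "a \<in> N w" and u: "u \<in> leg a" for a u v
    using r
  proof (induction rule: H.reachable_induct)
    case base then show ?case using u by simp
  next
    case (step x y)
    then obtain i where i: "1 \<le> i" "i \<le> len a" "x = path a i" unfolding leg_def by auto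
    have y: "y \<in> N x" "y \<noteq> w" using step aH by auto
    have "y = path a (i - 1) \<or> y = path a (Suc i) \<and> Suc i \<le> len a"
      using y(1) N_path[OF a i(1,2)] unfolding i(3) by (auto split: if_splits)
    moreover have "1 \<le> i - 1" if "y = path a (i - 1)" using y(2) that by (cases "i - 1") auto
    moreover have "i - 1 \<le> len a" using i by simp
    ultimately have "\<exists>j\<in>{1..len a}. y = path a j" by (metis atLeastAtMost_iff le_add1 plus_1_eq_Suc)
    then show ?case unfolding leg_def by blast
  qed
  have ne: "leg a \<noteq> {}" if "a \<in> N w" for a using len_pos[OF that] unfolding leg_def by auto
  have "leg a \<in> H.sccs_verts" if a: "a \<in> N w" for a
    unfolding H.in_sccs_verts_conv_reachable
  proof (intro conjI ballI allI impI)
    show "leg a \<noteq> {}" by (rule ne[OF a])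
    show "u \<rightarrow>\<^sup>*\<^bsub>H\<^esub> v" if "u \<in> leg a" "v \<in> leg a" for u v using strong[OF a that] .
    show "\<not> u \<rightarrow>\<^sup>*\<^bsub>H\<^esub> v \<or> \<not> v \<rightarrow>\<^sup>*\<^bsub>H\<^esub> u" if "u \<in> leg a" "v \<notin> leg a" for u v
      using closed[OF _ a that(1), of v] that(2) by blast
  qed
  moreover have "S \<in> leg ` N w" if S: "S \<in> H.sccs_verts" for S
  proof -
    have S': "S \<noteq> {}" "\<And>u v. u \<in> S \<Longrightarrow> v \<in> S \<Longrightarrow> u \<rightarrow>\<^sup>*\<^bsub>H\<^esub> v"
      "\<And>u v. u \<in> S \<Longrightarrow> v \<notin> S \<Longrightarrow> \<not> u \<rightarrow>\<^sup>*\<^bsub>H\<^esub> v \<or> \<not> v \<rightarrow>\<^sup>*\<^bsub>H\<^esub> u"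
      using S unfolding H.sccs_verts_def by blast+
    then obtain u where u: "u \<in> S" by blast
    then have "u \<in> verts H" using S'(2) H.reachable_in_verts by blast
    then have "u \<in> pverts G" "u \<noteq> w" using vH by auto
    then obtain a i where ai: "a \<in> N w" "i \<le> len a" "u = path a i" using verts_eq by blast
    then have "u \<in> leg a" using \<open>u \<noteq> w\<close> unfolding leg_def by (cases i) auto
    then have "S = leg a" using S'(2,3) u strong[OF ai(1)] closed[OF _ ai(1)] by blast
    then show ?thesis using ai by blast
  qed
  ultimately show ?thesis unfolding legs_def H_def[symmetric] by blast
qed

definition coord_dist :: "nat \<Rightarrow> nat \<Rightarrow> nat \<Rightarrow> nat \<Rightarrow> nat" where
  "coord_dist i j i' j' = (if i = i' then (j - j') + (j' - j) else j + j')"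

text \<open>Coordinate distance from the fixed start is a certificate for
  \<open>graph_dist_eqI\<close>.\<close>

lemma graph_dist_path:
  assumes g: "inj_on g I" "g ` I = N w" and i: "i \<in> I" "j \<le> len (g i)" and i': "i' \<in> I" "j' \<le> len (g i')"
  shows "graph_dist G (path (g i) j) (path (g i') j') = ereal (coord_dist i j i' j')"
proof -
  let ?f = "\<lambda>i j. path (g i) j"
  have gN: "g e \<in> N w" if "e \<in> I" for e using g that by blast
  have eq: "p = q \<and> (e = e' \<or> p = 0)"
    if "?f e p = ?f e' q" "e \<in> I" "e' \<in> I" "p \<le> len (g e)" "q \<le> len (g e')" for e e' p q
  proof (cases "p = 0 \<or> q = 0")
    case True
    then show ?thesis
      using path_neq_w[OF gN[OF that(2)], of p] path_neq_w[OF gN[OF that(3)], of q] that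
      by (cases p; cases q) auto
  next
    case False
    then show ?thesis using path_disjoint[OF gN[OF that(2)] gN[OF that(3)], of p q] that inj_onD[OF g(1)] by auto
  qed
  \<comment> \<open>The body has coordinates \<open>(e, 0)\<close> for every \<open>e\<close>, but
    \<open>coord_dist i j e 0 = j\<close> for all of them, so the described value is unique.\<close>
  define h where "h v = (THE m. \<exists>e\<in>I. \<exists>q\<le>len (g e). v = ?f e q \<and> m = coord_dist i j e q)" for v
  have h: "h (?f e q) = coord_dist i j e q" if "e \<in> I" "q \<le> len (g e)" for e q
    unfolding h_def
  proof (rule the_equality)
    show "\<exists>e'\<in>I. \<exists>q'\<le>len (g e'). ?f e q = ?f e' q' \<and> coord_dist i j e q = coord_dist i j e' q'"
      using that by blast
    fix m assume "\<exists>e'\<in>I. \<exists>q'\<le>len (g e'). ?f e q = ?f e' q' \<and> m = coord_dist i j e' q'"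
    then obtain e' q' where e': "e' \<in> I" "q' \<le> len (g e')" "?f e q = ?f e' q'" "m = coord_dist i j e' q'" by blast
    from eq[OF e'(3) that(1) e'(1) that(2) e'(2)]
    show "m = coord_dist i j e q" using e'(4) unfolding coord_dist_def by auto
  qed
  have V: "\<exists>e\<in>I. \<exists>q\<le>len (g e). v = ?f e q" if vV: "v \<in> pverts G" for v
  proof (cases "v = w")
    case True
    then have "v = ?f i 0" by simp
    then show ?thesis using i(1) by blast
  next
    case False
    then obtain a q where a: "a \<in> N w" "q \<le> len a" "v = path a q" using verts_eq vV by blast
    then obtain e where e: "e \<in> I" "a = g e" using g(2) by blast
    show ?thesis by (rule bexI[OF _ e(1)], rule exI[of _ q]) (use a e in simp)
  qed
  have fV: "?f e q \<in> pverts G" if "e \<in> I" "q \<le> len (g e)" for e q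
    using path_in_verts[OF gN[OF that(1)] that(2)] .
  have "graph_dist G (?f i j) (?f i' j') = ereal (h (?f i' j'))"
  proof (rule graph_dist_eqI)
    show "?f i j \<in> pverts G" "?f i' j' \<in> pverts G" using fV i i' by auto
    show "h (?f i j) = 0" using h[OF i] unfolding coord_dist_def by simp
  next
    fix x y assume xy: "(x, y) \<in> parcs G"
    then have x: "x \<in> pverts G" "y \<in> N x" using in_arcsD1 unfolding N_def by auto
    obtain e q where e: "e \<in> I" "q \<le> len (g e)" "x = ?f e q" using V[OF x(1)] by blast
    show "h y \<le> h x + 1"
    proof (cases "q = 0")
      case True
      then have "y \<in> N w" using x e by simp
      then obtain e' where e': "e' \<in> I" "y = g e'" using g by blast
      then have "y = ?f e' 1" "1 \<le> len (g e')" "x = ?f e' 0" using len_pos[OF gN[OF e'(1)]] e True by auto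
      then show ?thesis using h[OF e'(1), of 1] h[OF e'(1), of 0] unfolding coord_dist_def by (cases "i = e'") auto
    next
      case False
      then have q1: "1 \<le> q" by simp
      have "y = ?f e (q - 1) \<or> y = ?f e (Suc q) \<and> Suc q \<le> len (g e)"
        using x(2) N_path[OF gN[OF e(1)] q1 e(2)] unfolding e(3) by (auto split: if_splits)
      then show ?thesis
      proof
        assume "y = ?f e (q - 1)"
        then show ?thesis using h[OF e(1,2)] h[OF e(1), of "q - 1"] e unfolding coord_dist_def by auto
      next
        assume "y = ?f e (Suc q) \<and> Suc q \<le> len (g e)"
        then show ?thesis using h[OF e(1,2)] h[OF e(1), of "Suc q"] e unfolding coord_dist_def by auto
      qed
    qed
  next
    fix v assume v: "v \<in> pverts G" "0 < h v"
    then obtain e q where e: "e \<in> I" "q \<le> len (g e)" "v = ?f e q" using V by blast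
    have pos: "0 < coord_dist i j e q" using v(2) h[OF e(1,2)] e(3) by simp
    have down: "\<exists>y. (y, v) \<in> parcs G \<and> h y + 1 = h v"
      if "e' \<in> I" "q' \<le> len (g e')" "?f e' q' \<in> N v" "coord_dist i j e' q' + 1 = coord_dist i j e q" for e' q'
      using that h[OF that(1,2)] h[OF e(1,2)] e(3) N_sym[of "?f e' q'" v] unfolding N_def by auto
    show "\<exists>y. (y, v) \<in> parcs G \<and> h y + 1 = h v"
    proof (cases "q = 0")
      case True
      then have j0: "0 < j" using pos unfolding coord_dist_def by (auto split: if_splits)
      show ?thesis
      proof (rule down[OF i(1), of 1])
        show "?f i 1 \<in> N v" using True e gN[OF i(1)] by simp
      qed (use j0 True i in \<open>auto simp: coord_dist_def\<close>)
    next
      case False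
      then have prev: "?f e (q - 1) \<in> N v" using N_path[OF gN[OF e(1)] _ e(2)] e(3) by auto
      \<comment> \<open>The step towards the start leads inward, except from a vertex on the start's
        own leg that is nearer to the body.\<close>
      show ?thesis
      proof (cases "e = i \<and> q < j")
        case True
        then have "?f e (Suc q) \<in> N v" using path_edge_len[OF gN[OF e(1)]] i e by simp
        then show ?thesis by (rule down[OF e(1), of "Suc q", rotated]) (use True i in \<open>auto simp: coord_dist_def\<close>)
      next
        case F: False
        show ?thesis by (rule down[OF e(1) _ prev]) (use F False e pos in \<open>auto simp: coord_dist_def\<close>)
      qed
    qed
  next
    fix v assume v: "v \<in> pverts G" "h v = 0"
    then obtain e q where e: "e \<in> I" "q \<le> len (g e)" "v = ?f e q" using V by blast
    then have "coord_dist i j e q = 0" using v(2) h[OF e(1,2)] by simp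
    then show "v = ?f i j" using e(3) unfolding coord_dist_def by (cases "i = e") auto
  qed
  then show ?thesis using h[OF i'] by simp
qed

end

text \<open>The last clause says that rounding to \<open>nat\<close> loses nothing, so comparisons
  of \<open>graph_dist\<close> can be made between natural numbers.\<close>

lemma spider_coordinates:
  assumes "is_SP G w k l"
  obtains f where "spider_metric k l f (\<lambda>u v. nat \<lfloor>real_of_ereal (graph_dist G u v)\<rfloor>)"
    "pverts G = {f i j | i j. i \<in> {1..k} \<and> j \<le> l i}"
    "\<And>u v. u \<in> pverts G \<Longrightarrow> v \<in> pverts G \<Longrightarrow>
      graph_dist G u v = ereal (real (nat \<lfloor>real_of_ereal (graph_dist G u v)\<rfloor>))"
proof -
  from assms have sp: "spider G w" and k: "3 \<le> k" and pos: "\<forall>i\<in>{1..k}. 1 \<le> l i"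
    and mono: "\<forall>i\<in>{1..k}. \<forall>j\<in>{1..k}. i \<le> j \<longrightarrow> l i \<le> l j"
    unfolding is_SP_def by auto
  from assms obtain L where L: "bij_betw L {1..k} (legs G w)" "\<forall>i\<in>{1..k}. card (L i) = l i"
    unfolding is_SP_def by auto
  from sp interpret pair_graph G unfolding spider_def by blast
  interpret spider_graph G w
    by unfold_locales (use sp in \<open>auto simp: spider_def not_less[symmetric]\<close>)
  \<comment> \<open>The neighbour of the body whose leg is the prescribed \<open>L i\<close>; this
    carries the sorted lengths over to the paths.\<close>
  define g where "g i = inv_into (N w) leg (L i)" for i
  have bl: "bij_betw leg (N w) (legs G w)" using inj_leg legs_eq unfolding bij_betw_def by simp
  have "bij_betw (inv_into (N w) leg \<circ> L) {1..k} (N w)"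
    by (rule bij_betw_trans[OF L(1) bij_betw_inv_into[OF bl]])
  then have g: "inj_on g {1..k}" "g ` {1..k} = N w" unfolding bij_betw_def g_def comp_def by auto
  have gN: "g i \<in> N w" if "i \<in> {1..k}" for i using g that by blast
  have len: "len (g i) = l i" if i: "i \<in> {1..k}" for i
  proof -
    have "L i \<in> leg ` N w" using L(1) i legs_eq unfolding bij_betw_def by blast
    then have "leg (g i) = L i" unfolding g_def by (rule f_inv_into_f)
    then show ?thesis using card_leg[OF gN[OF i]] L(2) i by simp
  qed
  define f where "f i j = path (g i) j" for i j
  have dist: "graph_dist G (f i j) (f i' j') = ereal (coord_dist i j i' j')"
    if "i \<in> {1..k}" "i' \<in> {1..k}" "j \<le> l i" "j' \<le> l i'" for i i' j j'
    unfolding f_def using graph_dist_path[OF g that(1) _ that(2)] that len by simp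
  have V: "pverts G = {f i j | i j. i \<in> {1..k} \<and> j \<le> l i}"
  proof (intro equalityI subsetI)
    fix v assume v: "v \<in> pverts G"
    show "v \<in> {f i j | i j. i \<in> {1..k} \<and> j \<le> l i}"
    proof (cases "v = w")
      case True
      then have "v = f 1 0" "1 \<in> {1..k}" using k unfolding f_def by auto
      then show ?thesis by blast
    next
      case False
      then obtain a j where a: "a \<in> N w" "j \<le> len a" "v = path a j" using verts_eq v by blast
      then obtain i where "i \<in> {1..k}" "a = g i" using g by blast
      then show ?thesis using a len unfolding f_def by auto
    qed
  next
    fix v assume "v \<in> {f i j | i j. i \<in> {1..k} \<and> j \<le> l i}"
    then show "v \<in> pverts G" using path_in_verts[OF gN] len unfolding f_def by auto
  qed
  have D: "nat \<lfloor>real_of_ereal (graph_dist G (f i j) (f i' j'))\<rfloor> = coord_dist i j i' j'"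
    if "i \<in> {1..k}" "i' \<in> {1..k}" "j \<le> l i" "j' \<le> l i'" for i i' j j'
    using dist[OF that] by simp
  have "spider_metric k l f (\<lambda>u v. nat \<lfloor>real_of_ereal (graph_dist G u v)\<rfloor>)"
  proof
    show "nat \<lfloor>real_of_ereal (graph_dist G (f i j) (f i' j'))\<rfloor> = (if i = i' then j - j' + (j' - j) else j + j')"
      if "i \<in> {1..k}" "i' \<in> {1..k}" "j \<le> l i" "j' \<le> l i'" for i i' j j'
      using D[OF that] unfolding coord_dist_def .
    show "f i j = f i' j'"
      if "i \<in> {1..k}" "i' \<in> {1..k}" "j \<le> l i" "j' \<le> l i'"
        "nat \<lfloor>real_of_ereal (graph_dist G (f i j) (f i' j'))\<rfloor> = 0" for i i' j j'
    proof -
      have "coord_dist i j i' j' = 0" using D[OF that(1-4)] that(5) by simp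
      then show ?thesis unfolding coord_dist_def f_def by (cases "i = i'") auto
    qed
  qed (use k pos mono in auto)
  moreover have "graph_dist G u v = ereal (real (nat \<lfloor>real_of_ereal (graph_dist G u v)\<rfloor>))"
    if uv: "u \<in> pverts G" "v \<in> pverts G" for u v
  proof -
    obtain i j i' j' where "i \<in> {1..k}" "j \<le> l i" "u = f i j" "i' \<in> {1..k}" "j' \<le> l i'" "v = f i' j'"
      using uv unfolding V by blast
    then show ?thesis using dist[of i i' j j'] by simp
  qed
  ultimately show thesis by (rule that[OF _ V])
qed

theorem theorem5p18:
  fixes G :: "'a pair_pre_digraph" and w :: 'a and k :: nat and l :: "nat \<Rightarrow> nat"
  assumes "is_SP G w k l"
  shows "int (ldc G) =
    (if l k = 1 then 3
     else if k = 3 \<and> l 1 = 1 then int (l 3) + 2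
     else if k = 3 \<and> l 1 \<ge> 2 then \<lfloor>real (l 3) / 2\<rfloor> + 2
     else if k \<ge> 4 \<and> l 1 = 1 \<and> condition_E k l then \<lceil>real (l k) / 2\<rceil> + 2
     else \<lceil>real (l k) / 2\<rceil> + 1)"
proof -
  define d where "d u v = nat \<lfloor>real_of_ereal (graph_dist G u v)\<rfloor>" for u v
  obtain f where "spider_metric k l f d" and V: "pverts G = {f i j | i j. i \<in> {1..k} \<and> j \<le> l i}"
    and dist: "\<And>u v. u \<in> pverts G \<Longrightarrow> v \<in> pverts G \<Longrightarrow> graph_dist G u v = ereal (real (d u v))"
    unfolding d_def by (rule spider_coordinates[OF assms]) blast
  interpret M: spider_metric k l f d by fact
  have VM: "pverts G = M.V" unfolding V M.V_def ..
  have cons: "consistent_verts G c = M.consistent_set (\<lambda>v. int (c v))" for c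
  proof -
    have "consistent G c u \<longleftrightarrow> M.consistent_at (\<lambda>v. int (c v)) u" if "u \<in> pverts G" for u
      using that dist unfolding consistent_def M.consistent_at_def label_dist_def VM by simp
    then show ?thesis unfolding consistent_verts_def M.consistent_set_def VM by blast
  qed
  have lab: "M.interval_labeling (\<lambda>v. int (c v))" if "labeling G c" for c
  proof -
    have c: "inj_on c M.V" "c ` M.V = {1..card M.V}"
      using that unfolding labeling_def bij_betw_def VM by auto
    have "(\<lambda>v. int (c v)) ` M.V = int ` (c ` M.V)" by (simp add: image_image)
    also have "\<dots> = {1..int (card M.V)}" unfolding c(2) by (simp add: image_int_atLeastAtMost)
    finally show ?thesis using c(1) unfolding M.interval_labeling_def inj_on_def by auto
  qed
  have up: "card (consistent_verts G c) \<le> M.ldc_value" if "labeling G c" for c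
    using M.upper_bound[OF lab[OF that]] cons by simp
  obtain c where c: "labeling G c" "M.ldc_value \<le> card (consistent_verts G c)"
    using M.lower_bound unfolding labeling_def VM cons by blast
  have "ldc G = M.ldc_value"
    unfolding ldc_def
  proof (rule Max_eqI)
    show "finite {card (consistent_verts G c) |c. labeling G c}"
      by (rule finite_subset[of _ "{..M.ldc_value}"]) (use up in auto)
    show "M.ldc_value \<in> {card (consistent_verts G c) |c. labeling G c}"
      using c up[OF c(1)] by (auto intro!: exI[of _ c])
  qed (use up in auto)
  moreover have "\<lfloor>real n / 2\<rfloor> = int (n div 2)" for n :: nat
    by (metis floor_divide_of_nat_eq of_nat_numeral)
  moreover have "\<lceil>real n / 2\<rceil> = int ((n + 1) div 2)" for n :: nat
  proof (rule ceiling_unique)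
    have "n \<le> 2 * ((n + 1) div 2)" "2 * ((n + 1) div 2) \<le> n + 1" by linarith+
    then show "real_of_int (int ((n + 1) div 2)) - 1 < real n / 2" "real n / 2 \<le> real_of_int (int ((n + 1) div 2))"
      by linarith+
  qed
  \<comment> \<open>Together with \<open>3 <= k\<close> this makes the explicit tests
    \<open>l 1 >= 2\<close> and \<open>k >= 4\<close> agree with the nested branches of
    \<open>ldc_value\<close>.\<close>
  moreover have "1 \<le> l 1" using M.l_pos[of 1] M.k_ge by simp
  ultimately show ?thesis unfolding M.ldc_value_def using M.k_ge by auto
qed

end
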